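(* Let $G=A*B$ be a free product of groups, let $a\in A\setminus\{\mathrm{id}\}$ and $b\in B\setminus\{\mathrm{id}\}$. Then $$\mathrm{scl}_G([a,b])=\frac12-\frac1k,$$ where $2\le k\le+\infty$ is the minimum of the orders of $a$ and $b$ (with $1/\infty=0$).
   Context: For a group $G$ and $g\in[G,G]$, the commutator length $\mathrm{cl}(g)$ is the minimal $n$ such that $g$ is a product of $n$ commutators in $G$, and $\mathrm{scl}_G(g)=\lim_{n\to\infty}\mathrm{cl}(g^n)/n$. *)

theory Defs
  imports "HOL-Algebra.Algebra" "HOL-Analysis.Analysis"
begin

section \<open>Stable commutator length\<close>

definition commutator :: "('g, 'm) monoid_scheme \<Rightarrow> 'g \<Rightarrow> 'g \<Rightarrow> 'g" where
  "commutator G x y = x \<otimes>\<^bsub>G\<^esub> y \<otimes>\<^bsub>G\<^esub> inv\<^bsub>G\<^esub> x \<otimes>\<^bsub>G\<^esub> inv\<^bsub>G\<^esub> y"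

definition commutators :: "('g, 'm) monoid_scheme \<Rightarrow> 'g set" where
  "commutators G = {commutator G x y | x y. x \<in> carrier G \<and> y \<in> carrier G}"

text \<open>Meaningful for elements of the commutator subgroup only: outside it the set of
  admissible \<open>n\<close> is empty and the value of \<open>LEAST\<close> is unspecified.\<close>

definition commutator_length :: "('g, 'm) monoid_scheme \<Rightarrow> 'g \<Rightarrow> nat" where
  "commutator_length G g =
     (LEAST n. \<exists>cs. length cs = n \<and> set cs \<subseteq> commutators G \<and> foldr (\<otimes>\<^bsub>G\<^esub>) cs \<one>\<^bsub>G\<^esub> = g)"

definition scl :: "('g, 'm) monoid_scheme \<Rightarrow> 'g \<Rightarrow> real" where
  "scl G g = lim (\<lambda>n. real (commutator_length G (g [^]\<^bsub>G\<^esub> n)) / real n)"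

text \<open>The library's \<open>group.ord\<close> is \<open>0\<close> on elements of infinite order.\<close>

definition element_order :: "('g, 'm) monoid_scheme \<Rightarrow> 'g \<Rightarrow> enat" where
  "element_order G x = (if group.ord G x = 0 then \<infinity> else enat (group.ord G x))"

section \<open>Free products\<close>

text \<open>The elements of \<open>A * B\<close> are the reduced words: sequences of nontrivial elements taken
  alternately from the two factors. \<open>push A B l w\<close> is the normal form of the product of the
  letter \<open>l\<close> and the reduced word \<open>w\<close>.\<close>

definition letters ::
  "('a, 'm) monoid_scheme \<Rightarrow> ('b, 'n) monoid_scheme \<Rightarrow> ('a + 'b) set" where
  "letters A B = Inl ` (carrier A - {\<one>\<^bsub>A\<^esub>}) \<union> Inr ` (carrier B - {\<one>\<^bsub>B\<^esub>})"

definition reduced_words ::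
  "('a, 'm) monoid_scheme \<Rightarrow> ('b, 'n) monoid_scheme \<Rightarrow> ('a + 'b) list set" where
  "reduced_words A B =
     {w. set w \<subseteq> letters A B \<and> successively (\<lambda>x y. isl x \<noteq> isl y) w}"

fun push ::
  "('a, 'm) monoid_scheme \<Rightarrow> ('b, 'n) monoid_scheme \<Rightarrow> 'a + 'b \<Rightarrow> ('a + 'b) list \<Rightarrow> ('a + 'b) list"
where
  "push A B (Inl x) (Inl y # w) =
     (if x \<otimes>\<^bsub>A\<^esub> y = \<one>\<^bsub>A\<^esub> then w else Inl (x \<otimes>\<^bsub>A\<^esub> y) # w)"
| "push A B (Inr x) (Inr y # w) =
     (if x \<otimes>\<^bsub>B\<^esub> y = \<one>\<^bsub>B\<^esub> then w else Inr (x \<otimes>\<^bsub>B\<^esub> y) # w)"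
| "push A B (Inl x) w = (if x = \<one>\<^bsub>A\<^esub> then w else Inl x # w)"
| "push A B (Inr x) w = (if x = \<one>\<^bsub>B\<^esub> then w else Inr x # w)"

definition free_product ::
  "('a, 'm) monoid_scheme \<Rightarrow> ('b, 'n) monoid_scheme \<Rightarrow> ('a + 'b) list monoid" where
  "free_product A B =
     \<lparr>carrier = reduced_words A B, monoid.mult = foldr (push A B), one = []\<rparr>"

definition fp_inl :: "('a, 'm) monoid_scheme \<Rightarrow> 'a \<Rightarrow> ('a + 'b) list" where
  "fp_inl A a = (if a = \<one>\<^bsub>A\<^esub> then [] else [Inl a])"

definition fp_inr :: "('b, 'n) monoid_scheme \<Rightarrow> 'b \<Rightarrow> ('a + 'b) list" where
  "fp_inr B b = (if b = \<one>\<^bsub>B\<^esub> then [] else [Inr b])"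

subsection \<open>The group structure and the universal property\<close>

definition all_letters ::
  "('a, 'm) monoid_scheme \<Rightarrow> ('b, 'n) monoid_scheme \<Rightarrow> ('a + 'b) set" where
  "all_letters A B = Inl ` carrier A \<union> Inr ` carrier B"

lemma reduced_words_Nil [simp]: "[] \<in> reduced_words A B"
  by (simp add: reduced_words_def)

lemma reduced_words_Cons:
  "l # w \<in> reduced_words A B \<longleftrightarrow>
     l \<in> letters A B \<and> w \<in> reduced_words A B \<and> (w = [] \<or> isl l \<noteq> isl (hd w))"
  by (auto simp: reduced_words_def successively_Cons)

lemma letters_all: "l \<in> letters A B \<Longrightarrow> l \<in> all_letters A B"
  by (auto simp: letters_def all_letters_def)

context
  fixes A :: "('a, 'm) monoid_scheme" and B :: "('b, 'n) monoid_scheme"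
  assumes A: "group A" and B: "group B"
begin

interpretation A: group A by (rule A)
interpretation B: group B by (rule B)

lemma push_closed:
  assumes "l \<in> all_letters A B" "w \<in> reduced_words A B"
  shows "push A B l w \<in> reduced_words A B"
  using assms
  by (cases "(A, B, l, w)" rule: push.cases)
     (auto simp: reduced_words_Cons letters_def all_letters_def neq_Nil_conv split: if_splits)

lemma push_Cons:
  assumes "l # w \<in> reduced_words A B"
  shows "push A B l w = l # w"
  using assms
  by (cases "(A, B, l, w)" rule: push.cases)
     (auto simp: reduced_words_Cons letters_def)

lemma push_one:
  assumes "w \<in> reduced_words A B"
  shows "push A B (Inl \<one>\<^bsub>A\<^esub>) w = w" "push A B (Inr \<one>\<^bsub>B\<^esub>) w = w"
proof -
  show "push A B (Inl \<one>\<^bsub>A\<^esub>) w = w"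
    using assms by (cases "(A, B, Inl \<one>\<^bsub>A\<^esub> :: 'a + 'b, w)" rule: push.cases)
      (auto simp: reduced_words_Cons letters_def)
  show "push A B (Inr \<one>\<^bsub>B\<^esub>) w = w"
    using assms by (cases "(A, B, Inr \<one>\<^bsub>B\<^esub> :: 'a + 'b, w)" rule: push.cases)
      (auto simp: reduced_words_Cons letters_def)
qed

lemma push_push_Inl:
  assumes x: "x \<in> carrier A" and y: "y \<in> carrier A" and w: "w \<in> reduced_words A B"
  shows "push A B (Inl x) (push A B (Inl y) w) = push A B (Inl (x \<otimes>\<^bsub>A\<^esub> y)) w"
proof (cases "\<exists>z v. w = Inl z # v")
  case True
  then obtain z v where wv: "w = Inl z # v" by blast
  have z: "z \<in> carrier A" "z \<noteq> \<one>\<^bsub>A\<^esub>" and v: "v = [] \<or> (\<exists>c u. v = Inr c # u)"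
    using w wv by (auto simp: reduced_words_Cons letters_def neq_Nil_conv)
  have "x \<otimes>\<^bsub>A\<^esub> y \<otimes>\<^bsub>A\<^esub> z = x \<otimes>\<^bsub>A\<^esub> (y \<otimes>\<^bsub>A\<^esub> z)" using x y z A.m_assoc by blast
  then show ?thesis using x v wv by auto
next
  case False
  then have "w = [] \<or> (\<exists>c u. w = Inr c # u)"
    by (metis list.exhaust sum.exhaust)
  then show ?thesis using x y by auto
qed

lemma push_push_Inr:
  assumes x: "x \<in> carrier B" and y: "y \<in> carrier B" and w: "w \<in> reduced_words A B"
  shows "push A B (Inr x) (push A B (Inr y) w) = push A B (Inr (x \<otimes>\<^bsub>B\<^esub> y)) w"
proof (cases "\<exists>z v. w = Inr z # v")
  case True
  then obtain z v where wv: "w = Inr z # v" by blast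
  have z: "z \<in> carrier B" "z \<noteq> \<one>\<^bsub>B\<^esub>" and v: "v = [] \<or> (\<exists>c u. v = Inl c # u)"
    using w wv by (auto simp: reduced_words_Cons letters_def neq_Nil_conv)
  have "x \<otimes>\<^bsub>B\<^esub> y \<otimes>\<^bsub>B\<^esub> z = x \<otimes>\<^bsub>B\<^esub> (y \<otimes>\<^bsub>B\<^esub> z)" using x y z B.m_assoc by blast
  then show ?thesis using x v wv by auto
next
  case False
  then have "w = [] \<or> (\<exists>c u. w = Inl c # u)"
    by (metis list.exhaust sum.exhaust)
  then show ?thesis using x y by auto
qed

lemma foldr_push_closed:
  assumes "u \<in> reduced_words A B" "v \<in> reduced_words A B"
  shows "foldr (push A B) u v \<in> reduced_words A B"
  using assms by (induction u) (auto simp: reduced_words_Cons letters_all push_closed)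

lemma push_foldr:
  assumes l: "l \<in> all_letters A B" and u: "u \<in> reduced_words A B" and v: "v \<in> reduced_words A B"
  shows "foldr (push A B) (push A B l u) v = push A B l (foldr (push A B) u v)"
proof (cases "(A, B, l, u)" rule: push.cases)
  case (1 A' B' x y w)
  then have eq: "l = Inl x" "u = Inl y # w" by auto
  have xy: "x \<in> carrier A" "y \<in> carrier A" and w: "w \<in> reduced_words A B"
    using l u eq by (auto simp: all_letters_def reduced_words_Cons letters_def)
  show ?thesis
    using push_push_Inl[OF xy foldr_push_closed[OF w v]] push_one(1)[OF foldr_push_closed[OF w v]]
    by (simp add: eq)
next
  case (2 A' B' x y w)
  then have eq: "l = Inr x" "u = Inr y # w" by auto
  have xy: "x \<in> carrier B" "y \<in> carrier B" and w: "w \<in> reduced_words A B"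
    using l u eq by (auto simp: all_letters_def reduced_words_Cons letters_def)
  show ?thesis
    using push_push_Inr[OF xy foldr_push_closed[OF w v]] push_one(2)[OF foldr_push_closed[OF w v]]
    by (simp add: eq)
qed (use push_one[OF foldr_push_closed[OF u v]] push_one[OF v] in auto)

lemma foldr_push_assoc:
  assumes "u \<in> reduced_words A B" "v \<in> reduced_words A B" "w \<in> reduced_words A B"
  shows "foldr (push A B) (foldr (push A B) u v) w = foldr (push A B) u (foldr (push A B) v w)"
  using assms
proof (induction u)
  case (Cons l u)
  then show ?case
    by (simp add: push_foldr foldr_push_closed reduced_words_Cons letters_all)
qed simp

lemma foldr_push_Nil: "u \<in> reduced_words A B \<Longrightarrow> foldr (push A B) u [] = u"
proof (induction u)
  case (Cons l u)
  then have "foldr (push A B) u [] = u" by (simp add: reduced_words_Cons)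
  then show ?case using push_Cons[OF Cons.prems] by simp
qed simp

lemma foldr_push_inv:
  assumes "u \<in> reduced_words A B"
  shows "\<exists>v \<in> reduced_words A B. foldr (push A B) v u = []"
  using assms
proof (induction u)
  case Nil
  show ?case by (rule bexI[of _ "[]"]) auto
next
  case (Cons l u)
  then have u: "u \<in> reduced_words A B" and l: "l \<in> letters A B"
    by (auto simp: reduced_words_Cons)
  obtain v where v: "v \<in> reduced_words A B" "foldr (push A B) v u = []"
    using Cons.IH u by blast
  obtain l' where l': "l' \<in> letters A B" "push A B l' (l # u) = u"
  proof (cases l)
    case (Inl x)
    have x: "x \<in> carrier A" "x \<noteq> \<one>\<^bsub>A\<^esub>" using l Inl by (auto simp: letters_def)
    have "Inl (inv\<^bsub>A\<^esub> x) \<in> letters A B"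
      using x A.inv_eq_1_iff by (auto simp: letters_def)
    then show ?thesis using that[of "Inl (inv\<^bsub>A\<^esub> x)"] x Inl by simp
  next
    case (Inr x)
    have x: "x \<in> carrier B" "x \<noteq> \<one>\<^bsub>B\<^esub>" using l Inr by (auto simp: letters_def)
    have "Inr (inv\<^bsub>B\<^esub> x) \<in> letters A B"
      using x B.inv_eq_1_iff by (auto simp: letters_def)
    then show ?thesis using that[of "Inr (inv\<^bsub>B\<^esub> x)"] x Inr by simp
  qed
  have l'r: "[l'] \<in> reduced_words A B" using l' by (simp add: reduced_words_Cons)
  have "foldr (push A B) (foldr (push A B) v [l']) (l # u) = []"
    using foldr_push_assoc[OF v(1) l'r Cons.prems] l'(2) v(2) by simp
  then show ?case using foldr_push_closed[OF v(1) l'r] by blast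
qed

theorem group_free_product: "group (free_product A B)"
proof (rule groupI)
  fix u assume "u \<in> carrier (free_product A B)"
  then show "\<exists>v \<in> carrier (free_product A B).
      v \<otimes>\<^bsub>free_product A B\<^esub> u = \<one>\<^bsub>free_product A B\<^esub>"
    using foldr_push_inv by (simp add: free_product_def)
qed (simp_all add: free_product_def foldr_push_closed foldr_push_assoc)

lemma fp_inl_hom: "(fp_inl A :: 'a \<Rightarrow> ('a + 'b) list) \<in> hom A (free_product A B)"
  by (rule homI)
     (auto simp: fp_inl_def free_product_def reduced_words_Cons letters_def)

lemma fp_inr_hom: "(fp_inr B :: 'b \<Rightarrow> ('a + 'b) list) \<in> hom B (free_product A B)"
  by (rule homI)
     (auto simp: fp_inr_def free_product_def reduced_words_Cons letters_def)

theorem free_product_universal: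
  fixes H :: "('h, 'k) monoid_scheme"
  assumes H: "group H" and f: "f \<in> hom A H" and g: "g \<in> hom B H"
  shows "\<exists>h \<in> hom (free_product A B) H.
           (\<forall>a \<in> carrier A. h (fp_inl A a) = f a) \<and> (\<forall>b \<in> carrier B. h (fp_inr B b) = g b) \<and>
           (\<forall>h' \<in> hom (free_product A B) H.
              (\<forall>a \<in> carrier A. h' (fp_inl A a) = f a) \<and> (\<forall>b \<in> carrier B. h' (fp_inr B b) = g b)
              \<longrightarrow> (\<forall>w \<in> carrier (free_product A B). h' w = h w))"
proof -
  interpret H: group H by (rule H)
  define F where "F = case_sum f g"
  define h where "h w = foldr (\<lambda>l p. F l \<otimes>\<^bsub>H\<^esub> p) w \<one>\<^bsub>H\<^esub>" for w
  have f1: "f \<one>\<^bsub>A\<^esub> = \<one>\<^bsub>H\<^esub>" using hom_one[OF f A H] .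
  have g1: "g \<one>\<^bsub>B\<^esub> = \<one>\<^bsub>H\<^esub>" using hom_one[OF g B H] .
  have FC: "F l \<in> carrier H" if "l \<in> all_letters A B" for l
    using that f g by (auto simp: F_def all_letters_def hom_def)
  have hC: "h w \<in> carrier H" if "w \<in> reduced_words A B" for w
    using that by (induction w) (auto simp: h_def reduced_words_Cons letters_all FC)
  have h_simps: "h [] = \<one>\<^bsub>H\<^esub>" "h (l # w) = F l \<otimes>\<^bsub>H\<^esub> h w" for l w
    by (simp_all add: h_def)
  have hp: "h (push A B l w) = F l \<otimes>\<^bsub>H\<^esub> h w"
    if l: "l \<in> all_letters A B" and w: "w \<in> reduced_words A B" for l w
  proof (cases "(A, B, l, w)" rule: push.cases)
    case (1 A' B' x y v)
    then have eq: "l = Inl x" "w = Inl y # v" by auto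
    have xy: "x \<in> carrier A" "y \<in> carrier A" and v: "v \<in> reduced_words A B"
      using l w eq by (auto simp: all_letters_def reduced_words_Cons letters_def)
    have fxy: "f (x \<otimes>\<^bsub>A\<^esub> y) = f x \<otimes>\<^bsub>H\<^esub> f y" "f x \<in> carrier H" "f y \<in> carrier H"
      using f xy by (auto simp: hom_def)
    have "h (push A B l w) = f (x \<otimes>\<^bsub>A\<^esub> y) \<otimes>\<^bsub>H\<^esub> h v"
      using hC[OF v] by (simp add: eq h_simps F_def f1)
    then show ?thesis using fxy hC[OF v] by (simp add: eq h_simps F_def H.m_assoc)
  next
    case (2 A' B' x y v)
    then have eq: "l = Inr x" "w = Inr y # v" by auto
    have xy: "x \<in> carrier B" "y \<in> carrier B" and v: "v \<in> reduced_words A B"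
      using l w eq by (auto simp: all_letters_def reduced_words_Cons letters_def)
    have gxy: "g (x \<otimes>\<^bsub>B\<^esub> y) = g x \<otimes>\<^bsub>H\<^esub> g y" "g x \<in> carrier H" "g y \<in> carrier H"
      using g xy by (auto simp: hom_def)
    have "h (push A B l w) = g (x \<otimes>\<^bsub>B\<^esub> y) \<otimes>\<^bsub>H\<^esub> h v"
      using hC[OF v] by (simp add: eq h_simps F_def g1)
    then show ?thesis using gxy hC[OF v] by (simp add: eq h_simps F_def H.m_assoc)
  qed (use hC[OF w] in \<open>auto simp: h_simps F_def f1 g1\<close>)
  have hm: "h (foldr (push A B) u v) = h u \<otimes>\<^bsub>H\<^esub> h v"
    if "u \<in> reduced_words A B" and v: "v \<in> reduced_words A B" for u v
    using that(1)
  proof (induction u)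
    case Nil
    then show ?case using hC[OF v] by (simp add: h_simps)
  next
    case (Cons l u)
    then have lu: "l \<in> all_letters A B" "u \<in> reduced_words A B"
      by (auto simp: reduced_words_Cons letters_all)
    then show ?case
      using Cons.IH hp[OF lu(1) foldr_push_closed[OF lu(2) v]] FC[OF lu(1)] hC[OF lu(2)] hC[OF v]
      by (simp add: h_simps H.m_assoc)
  qed
  have hom: "h \<in> hom (free_product A B) H"
    by (rule homI) (simp_all add: free_product_def hC hm)
  have ha: "h (fp_inl A a) = f a" if "a \<in> carrier A" for a
    using that FC[of "Inl a"] f1 by (simp add: fp_inl_def h_simps F_def all_letters_def)
  have hb: "h (fp_inr B b) = g b" if "b \<in> carrier B" for b
    using that FC[of "Inr b"] g1 by (simp add: fp_inr_def h_simps F_def all_letters_def)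
  have uniq: "h' w = h w"
    if h': "h' \<in> hom (free_product A B) H"
      and a: "\<forall>a \<in> carrier A. h' (fp_inl A a) = f a"
      and b: "\<forall>b \<in> carrier B. h' (fp_inr B b) = g b"
      and w: "w \<in> reduced_words A B" for h' w
    using w
  proof (induction w)
    case Nil
    then show ?case
      using hom_one[OF h' group_free_product H] by (simp add: h_simps free_product_def)
  next
    case (Cons l w)
    then have lw: "l \<in> letters A B" "w \<in> reduced_words A B" by (auto simp: reduced_words_Cons)
    have l': "h' [l] = F l"
    proof (cases l)
      case (Inl x)
      then have x: "x \<in> carrier A" "x \<noteq> \<one>\<^bsub>A\<^esub>" using lw(1) by (auto simp: letters_def)
      have "h' (fp_inl A x) = f x" using a x(1) by blast
      then show ?thesis using x(2) Inl by (simp add: F_def fp_inl_def)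
    next
      case (Inr x)
      then have x: "x \<in> carrier B" "x \<noteq> \<one>\<^bsub>B\<^esub>" using lw(1) by (auto simp: letters_def)
      have "h' (fp_inr B x) = g x" using b x(1) by blast
      then show ?thesis using x(2) Inr by (simp add: F_def fp_inr_def)
    qed
    have "h' ([l] \<otimes>\<^bsub>free_product A B\<^esub> w) = h' [l] \<otimes>\<^bsub>H\<^esub> h' w"
      using lw by (intro hom_mult[OF h']) (auto simp: free_product_def reduced_words_Cons)
    moreover have "[l] \<otimes>\<^bsub>free_product A B\<^esub> w = l # w"
      using push_Cons[OF Cons.prems] by (simp add: free_product_def)
    ultimately show ?case using Cons.IH lw(2) l' by (simp add: h_simps)
  qed
  show ?thesis
  proof (intro bexI[of _ h] conjI ballI impI)
    fix h' w
    assume "h' \<in> hom (free_product A B) H" "w \<in> carrier (free_product A B)"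
      and "(\<forall>a \<in> carrier A. h' (fp_inl A a) = f a) \<and> (\<forall>b \<in> carrier B. h' (fp_inr B b) = g b)"
    then show "h' w = h w" by (intro uniq) (simp_all add: free_product_def)
  qed (fact hom | rule ha, assumption | rule hb, assumption)+
qed

end

end

theory Submission
  imports Defs
begin

text \<open>Upper bound: \<open>x\<^sup>2\<^sup>n y\<^sup>2\<^sup>n\<close> and \<open>(xy)\<^sup>2\<^sup>n\<close> differ by \<open>n\<close> commutators. Write \<open>[a, b] = a c\<close>, where
  \<open>c = b a\<^sup>-\<^sup>1 b\<^sup>-\<^sup>1\<close>. If \<open>a\<close> has order \<open>k\<close>, the relation \<open>c\<^sup>k = 1\<close> says that a product of \<open>k\<close>
  conjugates of \<open>[a, b]\<close> is trivial, hence \<open>[a, b]\<^sup>2\<^sup>n\<^sup>k\<close> is a product of about \<open>(k - 2) n\<close>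
  commutators; without any relation, \<open>[a, b]\<^sup>2\<^sup>n\<close> is a product of \<open>n + 1\<close> commutators.

  Lower bound: let \<open>s(a\<^sup>i) = 1 - 2i/k\<close> for \<open>0 < i < k\<close> (or the sign of \<open>i\<close> if \<open>a\<close> has infinite
  order), extended by \<open>0\<close> to the rest of \<open>A\<close>, and likewise on \<open>B\<close>. Summing \<open>\<plusminus> s(l) s(m)\<close> over
  adjacent letters \<open>l m\<close> of a reduced word gives an odd quasimorphism \<open>f\<close> of defect at most
  \<open>2 max (s a) (s b)\<close>, with \<open>f([a, b]\<^sup>n) = (4n - 1) s(a) s(b)\<close>. An odd quasimorphism of defect
  \<open>D\<close> is at most \<open>4 D m\<close> on products of \<open>m\<close> commutators, which bounds scl from below by
  \<open>min (s a) (s b) / 2\<close>. For infinite cyclic factors \<open>f\<close> counts the turns of a path on the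
  once-punctured torus.\<close>

section \<open>Products of commutators\<close>

text \<open>Membership in this set stands in for the \<open>LEAST\<close> of
  \<open>commutator_length\<close>, which is meaningful only once some product is known.\<close>

definition commutator_products :: "('g, 'm) monoid_scheme \<Rightarrow> nat \<Rightarrow> 'g set" where
  "commutator_products G n =
     {foldr (\<otimes>\<^bsub>G\<^esub>) cs \<one>\<^bsub>G\<^esub> | cs. length cs = n \<and> set cs \<subseteq> commutators G}"

context group
begin

lemma inv_cancel:
  "\<lbrakk>x \<in> carrier G; y \<in> carrier G\<rbrakk> \<Longrightarrow> inv x \<otimes> (x \<otimes> y) = y"
  "\<lbrakk>x \<in> carrier G; y \<in> carrier G\<rbrakk> \<Longrightarrow> x \<otimes> (inv x \<otimes> y) = y"
  by (simp_all flip: m_assoc)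

text \<open>Distributing inverses, associating to the right and cancelling inverse pairs lets
  \<open>simp\<close> prove the word identities below.\<close>

lemmas word_simps = m_assoc inv_cancel inv_mult_group

lemma commutator_closed [simp]:
  "\<lbrakk>x \<in> carrier G; y \<in> carrier G\<rbrakk> \<Longrightarrow> commutator G x y \<in> carrier G"
  by (simp add: commutator_def)

lemma inv_commutator:
  "\<lbrakk>x \<in> carrier G; y \<in> carrier G\<rbrakk> \<Longrightarrow> inv (commutator G x y) = commutator G y x"
  by (simp add: commutator_def word_simps)

lemma commutator_conj:
  "\<lbrakk>x \<in> carrier G; y \<in> carrier G; g \<in> carrier G\<rbrakk> \<Longrightarrow>
     g \<otimes> commutator G x y \<otimes> inv g = commutator G (g \<otimes> x \<otimes> inv g) (g \<otimes> y \<otimes> inv g)"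
  by (simp add: commutator_def word_simps)

lemma commutators_closed: "c \<in> commutators G \<Longrightarrow> c \<in> carrier G"
  by (auto simp: commutators_def)

lemma commutator_products_0: "commutator_products G 0 = {\<one>}"
  by (auto simp: commutator_products_def)

lemma commutator_products_Suc:
  "commutator_products G (Suc n) =
     {c \<otimes> z | c z. c \<in> commutators G \<and> z \<in> commutator_products G n}"
proof -
  have "x \<in> commutator_products G (Suc n)"
    if "c \<in> commutators G" "z \<in> commutator_products G n" "x = c \<otimes> z" for x c z
  proof -
    obtain cs where "z = foldr (\<otimes>) cs \<one>" "length cs = n" "set cs \<subseteq> commutators G"
      using \<open>z \<in> _\<close> by (auto simp: commutator_products_def)
    then show ?thesis
      using that by (auto simp: commutator_products_def intro!: exI[of _ "c # cs"])
  qed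
  moreover have "\<exists>c z. x = c \<otimes> z \<and> c \<in> commutators G \<and> z \<in> commutator_products G n"
    if "x \<in> commutator_products G (Suc n)" for x
    using that by (auto simp: commutator_products_def length_Suc_conv) blast
  ultimately show ?thesis by blast
qed

lemma commutator_products_closed:
  "z \<in> commutator_products G n \<Longrightarrow> z \<in> carrier G"
  by (induction n arbitrary: z)
    (auto simp: commutator_products_0 commutator_products_Suc commutators_closed)

lemma commutator_products_mult:
  assumes "x \<in> commutator_products G m" "y \<in> commutator_products G n"
  shows "x \<otimes> y \<in> commutator_products G (m + n)"
  using assms(1)
proof (induction m arbitrary: x)
  case 0
  then show ?case using assms(2) commutator_products_closed by (simp add: commutator_products_0)
next
  case (Suc m)
  then obtain c z where cz: "x = c \<otimes> z" "c \<in> commutators G" "z \<in> commutator_products G m"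
    by (auto simp: commutator_products_Suc)
  then have "x \<otimes> y = c \<otimes> (z \<otimes> y)"
    using assms(2) commutator_products_closed commutators_closed by (simp add: m_assoc)
  then show ?case using Suc.IH[OF cz(3)] cz(2) by (auto simp: commutator_products_Suc)
qed

lemma commutator_products_1: "commutator_products G (Suc 0) = commutators G"
  using commutators_closed by (auto simp: commutator_products_Suc commutator_products_0) (metis r_one)

lemma commutator_in_products:
  "\<lbrakk>x \<in> carrier G; y \<in> carrier G\<rbrakk> \<Longrightarrow> commutator G x y \<in> commutator_products G 1"
  by (auto simp: commutator_products_1 commutators_def)

lemma commutator_products_conj:
  assumes "x \<in> commutator_products G n" and g: "g \<in> carrier G"
  shows "g \<otimes> x \<otimes> inv g \<in> commutator_products G n"
  using assms(1)
proof (induction n arbitrary: x)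
  case 0
  then show ?case using g by (simp add: commutator_products_0)
next
  case (Suc n)
  then obtain u v z where uv: "x = commutator G u v \<otimes> z" "u \<in> carrier G" "v \<in> carrier G"
    and z: "z \<in> commutator_products G n"
    by (auto simp: commutator_products_Suc commutators_def)
  have "g \<otimes> x \<otimes> inv g = (g \<otimes> commutator G u v \<otimes> inv g) \<otimes> (g \<otimes> z \<otimes> inv g)"
    using uv z g commutator_products_closed by (simp add: word_simps)
  also have "g \<otimes> commutator G u v \<otimes> inv g \<in> commutators G"
    unfolding commutators_def commutator_conj[OF uv(2,3) g] using uv g by blast
  ultimately show ?case using Suc.IH[OF z] by (auto simp: commutator_products_Suc)
qed

lemma commutator_products_inv:
  "x \<in> commutator_products G n \<Longrightarrow> inv x \<in> commutator_products G n"
proof (induction n arbitrary: x)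
  case 0
  then show ?case by (simp add: commutator_products_0)
next
  case (Suc n)
  then obtain u v z where uv: "x = commutator G u v \<otimes> z" "u \<in> carrier G" "v \<in> carrier G"
    and z: "z \<in> commutator_products G n"
    by (auto simp: commutator_products_Suc commutators_def)
  have "inv x = inv z \<otimes> commutator G v u"
    using uv commutator_products_closed[OF z] by (simp add: inv_mult_group inv_commutator)
  then show ?case
    using commutator_products_mult[OF Suc.IH[OF z] commutator_in_products[OF uv(3,2)]] by simp
qed

lemma commutator_length_le:
  "x \<in> commutator_products G n \<Longrightarrow> commutator_length G x \<le> n"
  unfolding commutator_length_def commutator_products_def by (intro Least_le) auto

lemma commutator_length_attained:
  assumes "x \<in> commutator_products G n"
  shows "x \<in> commutator_products G (commutator_length G x)"
proof -
  have "\<exists>n cs. length cs = n \<and> set cs \<subseteq> commutators G \<and> foldr (\<otimes>) cs \<one> = x"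
    using assms by (auto simp: commutator_products_def)
  from LeastI_ex[OF this] show ?thesis
    unfolding commutator_length_def commutator_products_def by force
qed

lemma commutator_products_pow:
  "x \<in> commutator_products G m \<Longrightarrow> x [^] (n::nat) \<in> commutator_products G (n * m)"
proof (induction n)
  case (Suc n)
  from commutator_products_mult[OF Suc.IH[OF Suc.prems] Suc.prems]
  show ?case by (simp add: add.commute)
qed (simp add: commutator_products_0)

section \<open>Powers of a commutator as products of few commutators\<close>

lemma conj_pow:
  assumes "x \<in> carrier G" "g \<in> carrier G"
  shows "(g \<otimes> x \<otimes> inv g) [^] (n::nat) = g \<otimes> x [^] n \<otimes> inv g"
  using assms by (induction n) (simp_all add: word_simps)

text \<open>With \<open>W\<^sub>N = x\<^sup>N y\<^sup>N (xy)\<^sup>-\<^sup>N\<close> the induction rests on the identity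
  \<open>W\<^sub>N\<^sub>+\<^sub>2 = xy [y\<^sup>-\<^sup>1 x, x\<^sup>N y\<^sup>N\<^sup>+\<^sup>1] W\<^sub>N (xy)\<^sup>-\<^sup>1\<close>, which spends one commutator for two powers.\<close>

lemma pow_mult_pow_in_products:
  assumes x: "x \<in> carrier G" and y: "y \<in> carrier G"
  shows "\<exists>c \<in> commutator_products G n.
           x [^] (2 * n) \<otimes> y [^] (2 * n) = c \<otimes> (x \<otimes> y) [^] (2 * n)"
proof (induction n)
  case 0
  show ?case by (simp add: commutator_products_0)
next
  case (Suc n)
  define N where "N = 2 * n"
  obtain c where c: "c \<in> commutator_products G n" "x [^] N \<otimes> y [^] N = c \<otimes> (x \<otimes> y) [^] N"
    using Suc N_def by blast
  have cC: "c \<in> carrier G" using c(1) commutator_products_closed by blast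
  define e where "e = commutator G (inv y \<otimes> x) (x [^] N \<otimes> y [^] N \<otimes> y)"
  have [simp]: "e \<in> carrier G" using x y by (simp add: e_def)
  have "e \<otimes> c \<in> commutator_products G (1 + n)"
    unfolding e_def using x y by (intro commutator_products_mult commutator_in_products c) auto
  then have "(x \<otimes> y) \<otimes> (e \<otimes> c) \<otimes> inv (x \<otimes> y) \<in> commutator_products G (Suc n)"
    using commutator_products_conj[of _ "Suc n" "x \<otimes> y"] x y by simp
  moreover have "x [^] (2 * Suc n) \<otimes> y [^] (2 * Suc n) =
      (x \<otimes> y) \<otimes> (e \<otimes> c) \<otimes> inv (x \<otimes> y) \<otimes> (x \<otimes> y) [^] (2 * Suc n)"
  proof -
    have e: "e \<otimes> (x [^] N \<otimes> y [^] N) = inv y \<otimes> x \<otimes> x [^] N \<otimes> y [^] N \<otimes> y \<otimes> inv x"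
      using x y by (simp add: e_def commutator_def word_simps)
    have t: "(x \<otimes> y) [^] (2 * Suc n) = (x \<otimes> y) \<otimes> (x \<otimes> y) [^] N \<otimes> (x \<otimes> y)"
      using x y nat_pow_Suc2[of "x \<otimes> y" N] by (simp add: N_def)
    have "(x \<otimes> y) \<otimes> (e \<otimes> c) \<otimes> inv (x \<otimes> y) \<otimes> (x \<otimes> y) [^] (2 * Suc n) =
        (x \<otimes> y) \<otimes> (e \<otimes> (c \<otimes> (x \<otimes> y) [^] N)) \<otimes> (x \<otimes> y)"
      unfolding t using x y cC by (simp add: word_simps)
    also have "\<dots> = (x \<otimes> y) \<otimes> (inv y \<otimes> x \<otimes> x [^] N \<otimes> y [^] N \<otimes> y \<otimes> inv x) \<otimes> (x \<otimes> y)"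
      by (simp add: e flip: c(2))
    also have "\<dots> = x \<otimes> (x \<otimes> x [^] N) \<otimes> (y [^] N \<otimes> y \<otimes> y)"
      using x y by (simp add: word_simps)
    also have "x \<otimes> (x \<otimes> x [^] N) = x [^] (2 * Suc n)"
      using x nat_pow_Suc2[of x N] nat_pow_Suc2[of x "Suc N"] by (simp add: N_def)
    also have "y [^] N \<otimes> y \<otimes> y = y [^] (2 * Suc n)"
      by (simp add: N_def)
    finally show ?thesis by simp
  qed
  ultimately show ?case by blast
qed

text \<open>The induction step uses that \<open>c\<^sup>m\<^sup>+\<^sup>1 a\<^sup>m\<^sup>+\<^sup>1\<close> is conjugate to \<open>(ac) (c\<^sup>m a\<^sup>m)\<close>.\<close>

lemma commutator_pow_finite_aux:
  assumes a: "a \<in> carrier G" and c: "c \<in> carrier G"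
  shows "\<exists>w \<in> commutator_products G (1 + m * (n + 1)).
           (a \<otimes> c) [^] (2 * n * Suc m) = w \<otimes> (c [^] Suc m \<otimes> a [^] Suc m) [^] (2 * n)"
proof (induction m)
  case 0
  \<comment> \<open>\<open>a \<otimes> c\<close> is the conjugate of \<open>c \<otimes> a\<close> by
    \<open>a\<close>, and undoing a conjugation costs one commutator.\<close>
  define u where "u = commutator G a ((c \<otimes> a) [^] (2 * n))"
  have "a \<otimes> (c \<otimes> a) \<otimes> inv a = a \<otimes> c" using a c by (simp add: word_simps)
  then have "(a \<otimes> c) [^] (2 * n) = u \<otimes> (c \<otimes> a) [^] (2 * n)"
    using a c conj_pow[of "c \<otimes> a" a "2 * n"] by (simp add: u_def commutator_def word_simps)
  moreover have "u \<in> commutator_products G 1"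
    unfolding u_def using a c by (intro commutator_in_products) auto
  ultimately show ?case using a c by auto
next
  case (Suc m)
  define N g h z where "N = 2 * n" and "g = a \<otimes> c" and "h = c [^] Suc m \<otimes> a [^] Suc m"
    and "z = c [^] Suc (Suc m) \<otimes> a [^] Suc (Suc m)"
  have cl [simp]: "g \<in> carrier G" "h \<in> carrier G" "z \<in> carrier G"
    using a c by (simp_all add: g_def h_def z_def)
  obtain w where w: "w \<in> commutator_products G (1 + m * (n + 1))"
    and gw: "g [^] (N * Suc m) = w \<otimes> h [^] N"
    using Suc unfolding N_def g_def h_def by blast
  obtain v where v: "v \<in> commutator_products G n" and gh: "g [^] N \<otimes> h [^] N = v \<otimes> (g \<otimes> h) [^] N"
    using pow_mult_pow_in_products[of g h n] by (auto simp: N_def)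
  define u where "u = commutator G a (z [^] N)"
  have wv [simp]: "w \<in> carrier G" "v \<in> carrier G" "u \<in> carrier G"
    using w v a commutator_products_closed by (auto simp: u_def)
  have "a \<otimes> z \<otimes> inv a = g \<otimes> h"
  proof -
    have "z = c \<otimes> c [^] Suc m \<otimes> (a [^] Suc m \<otimes> a)"
      unfolding z_def nat_pow_Suc2[OF c, of "Suc m"] by simp
    then show ?thesis using a c by (simp add: g_def h_def word_simps)
  qed
  then have ghz: "(g \<otimes> h) [^] N = u \<otimes> z [^] N"
    using a conj_pow[of z a N] by (simp add: u_def commutator_def word_simps)
  have "g [^] (N * Suc (Suc m)) = g [^] N \<otimes> g [^] (N * Suc m)"
    by (simp add: nat_pow_mult)
  \<comment> \<open>Conjugating \<open>w\<close> keeps its number of commutators; the step then pays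
    \<open>n\<close> for \<open>v\<close> and one for \<open>u\<close>.\<close>
  also have "\<dots> = (g [^] N \<otimes> w \<otimes> inv (g [^] N)) \<otimes> (g [^] N \<otimes> h [^] N)"
    unfolding gw by (simp add: word_simps)
  also have "\<dots> = (g [^] N \<otimes> w \<otimes> inv (g [^] N)) \<otimes> (v \<otimes> u) \<otimes> z [^] N"
    unfolding gh ghz by (simp add: m_assoc)
  finally have "g [^] (N * Suc (Suc m)) = (g [^] N \<otimes> w \<otimes> inv (g [^] N)) \<otimes> (v \<otimes> u) \<otimes> z [^] N" .
  moreover have "(g [^] N \<otimes> w \<otimes> inv (g [^] N)) \<otimes> (v \<otimes> u)
      \<in> commutator_products G ((1 + m * (n + 1)) + (n + 1))"
    unfolding u_def using a
    by (intro commutator_products_mult commutator_products_conj w v commutator_in_products) auto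
  ultimately show ?case by (auto simp: N_def g_def z_def algebra_simps)
qed

text \<open>Here \<open>[a, b] = a c\<close> with \<open>c = b a\<^sup>-\<^sup>1 b\<^sup>-\<^sup>1\<close> and \<open>a\<^sup>k = c\<^sup>k = 1\<close>, so
  \<open>c\<^sup>k\<^sup>-\<^sup>1 a\<^sup>k\<^sup>-\<^sup>1 = [a, b]\<^sup>-\<^sup>1\<close>.\<close>

lemma commutator_pow_finite:
  assumes a: "a \<in> carrier G" and b: "b \<in> carrier G" and ak: "a [^] k = \<one>" and k: "k \<ge> (2::nat)"
  shows "commutator G a b [^] (2 * n * k) \<in> commutator_products G (1 + (k - 2) * (n + 1))"
proof -
  define c where "c = b \<otimes> inv a \<otimes> inv b"
  define g where "g = commutator G a b"
  have c: "c \<in> carrier G" and [simp]: "g \<in> carrier G" and g: "g = a \<otimes> c"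
    using a b by (simp_all add: c_def g_def commutator_def m_assoc)
  have ck: "c [^] k = \<one>"
    using a b conj_pow[of "inv a" b k] ak by (simp add: c_def nat_pow_inv)
  define m where "m = k - 2"
  have km: "k = Suc (Suc m)" using k by (simp add: m_def)
  have inv_k: "x [^] Suc m = inv x" if "x \<in> carrier G" "x [^] k = \<one>" for x
    using that by (intro inv_equality[symmetric]) (auto simp: km)
  have "c [^] Suc m \<otimes> a [^] Suc m = inv g"
    unfolding inv_k[OF c ck] inv_k[OF a ak] g using a c by (simp add: inv_mult_group)
  then obtain w where w: "w \<in> commutator_products G (1 + m * (n + 1))"
    and eq: "g [^] (2 * n * Suc m) = w \<otimes> inv g [^] (2 * n)"
    using commutator_pow_finite_aux[OF a c, of m n] by (auto simp: g)
  \<comment> \<open>The exponent is \<open>2 * n * (k - 1) + 2 * n\<close>; the second power cancels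
    \<open>inv g [^] (2 * n)\<close> and leaves \<open>w\<close>.\<close>
  have "g [^] (2 * n * k) = g [^] (2 * n * Suc m) \<otimes> g [^] (2 * n)"
    by (simp add: km nat_pow_mult algebra_simps)
  also have "\<dots> = w"
    unfolding eq using commutator_products_closed[OF w] by (simp add: nat_pow_inv m_assoc)
  finally show ?thesis using w by (simp add: g_def m_def)
qed

text \<open>As \<open>c\<close> is conjugate to \<open>inv a\<close>, the product
  \<open>a [^] (2 * n) \<otimes> c [^] (2 * n)\<close> is a single commutator, and it differs from
  \<open>(a \<otimes> c) [^] (2 * n)\<close> by \<open>n\<close> commutators.\<close>

lemma commutator_pow_infinite:
  assumes a: "a \<in> carrier G" and b: "b \<in> carrier G"
  shows "commutator G a b [^] (2 * n) \<in> commutator_products G (n + 1)"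
proof -
  define c where "c = b \<otimes> inv a \<otimes> inv b"
  define g where "g = commutator G a b"
  have c: "c \<in> carrier G" and g: "g = a \<otimes> c" and gG: "g \<in> carrier G"
    using a b by (simp_all add: c_def g_def commutator_def m_assoc)
  have "c [^] (2 * n) = b \<otimes> inv (a [^] (2 * n)) \<otimes> inv b"
    using a b conj_pow[of "inv a" b "2 * n"] by (simp add: c_def nat_pow_inv)
  then have ac: "a [^] (2 * n) \<otimes> c [^] (2 * n) = commutator G (a [^] (2 * n)) b"
    using a b by (simp add: commutator_def m_assoc)
  obtain w where w: "w \<in> commutator_products G n"
    and eq: "a [^] (2 * n) \<otimes> c [^] (2 * n) = w \<otimes> g [^] (2 * n)"
    using pow_mult_pow_in_products[OF a c, of n] by (auto simp: g)
  have "g [^] (2 * n) = inv w \<otimes> commutator G (a [^] (2 * n)) b"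
    unfolding ac[symmetric] eq using commutator_products_closed[OF w] gG by (simp add: inv_cancel)
  then show ?thesis
    using commutator_products_mult[OF commutator_products_inv[OF w] commutator_in_products] a b
    by (simp add: g_def)
qed

text \<open>Division with remainder by \<open>M\<close>: fewer than \<open>M\<close> factors
  \<open>g\<close> are left over, each a single commutator, so the error stays bounded in
  \<open>n\<close>.\<close>

lemma commutator_length_pow_le:
  assumes g: "g \<in> commutator_products G 1" and M: "M > 0"
    and per: "\<And>n. g [^] (n * M) \<in> commutator_products G (n * p + q)"
  shows "real (commutator_length G (g [^] n)) \<le> real p / real M * real n + real (q + M)"
proof -
  have gG: "g \<in> carrier G" using g commutator_products_closed by blast
  define d r where "d = n div M" and "r = n mod M"
  have n: "n = d * M + r" and r: "r < M" using M by (simp_all add: d_def r_def)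
  have "g [^] (d * M) \<otimes> g [^] r \<in> commutator_products G (d * p + q + r)"
    using commutator_products_mult[OF per[of d] commutator_products_pow[OF g, of r]] by simp
  then have "g [^] n \<in> commutator_products G (d * p + q + r)"
    using gG by (simp add: n nat_pow_mult)
  then have "commutator_length G (g [^] n) \<le> d * p + q + r" by (rule commutator_length_le)
  then have "real (commutator_length G (g [^] n)) \<le> real (d * p) + real (q + M)"
    using r by linarith
  moreover have "real (d * p) \<le> real p / real M * real n"
    using M by (simp add: n field_simps)
  ultimately show ?thesis by linarith
qed

text \<open>The quasimorphism need not be homogeneous: a commutator is a product of four elements whose
  values cancel in pairs, which costs \<open>3D\<close>, and attaching it to the product costs another \<open>D\<close>.\<close>

lemma quasimorphism_le_commutator_length:
  fixes f :: "'a \<Rightarrow> real"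
  assumes odd: "\<And>x. x \<in> carrier G \<Longrightarrow> f (inv x) = - f x"
    and defect: "\<And>x y. \<lbrakk>x \<in> carrier G; y \<in> carrier G\<rbrakk> \<Longrightarrow> \<bar>f (x \<otimes> y) - f x - f y\<bar> \<le> D"
    and z: "z \<in> commutator_products G n"
  shows "f z \<le> 4 * D * real (commutator_length G z)"
proof -
  have f1: "f \<one> = 0" using odd[of \<one>] by simp
  have f_comm: "f (commutator G x y) \<le> 3 * D" if xy: "x \<in> carrier G" "y \<in> carrier G" for x y
    using defect[of x y] defect[of "x \<otimes> y" "inv x"] defect[of "x \<otimes> y \<otimes> inv x" "inv y"]
      odd[of x] odd[of y] xy
    by (simp add: commutator_def)
  have "f z \<le> 4 * D * real m" if "z \<in> commutator_products G m" for m
    using that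
  proof (induction m arbitrary: z)
    case 0
    then show ?case using f1 by (simp add: commutator_products_0)
  next
    case (Suc m)
    then obtain x y w where w: "z = commutator G x y \<otimes> w" "w \<in> commutator_products G m"
      and xy: "x \<in> carrier G" "y \<in> carrier G"
      by (auto simp: commutator_products_Suc commutators_def)
    have "\<bar>f z - f (commutator G x y) - f w\<bar> \<le> D"
      unfolding w(1) using w(2) xy commutator_products_closed by (intro defect) auto
    then show ?case using Suc.IH[OF w(2)] f_comm[OF xy] by (simp add: algebra_simps)
  qed
  then show ?thesis using commutator_length_attained[OF z] by blast
qed

end

text \<open>A bounded error disappears after division by \<open>n\<close>. The sandwich also yields
  convergence, on which the meaning of \<open>lim\<close> depends.\<close>

lemma scl_eqI:
  assumes "\<And>n. L * real n - C \<le> real (commutator_length G (g [^]\<^bsub>G\<^esub> n))"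
    and "\<And>n. real (commutator_length G (g [^]\<^bsub>G\<^esub> n)) \<le> L * real n + C'"
  shows "scl G g = L"
proof -
  have "(\<lambda>n. real (commutator_length G (g [^]\<^bsub>G\<^esub> n)) / real n) \<longlonglongrightarrow> L"
  proof (rule tendsto_sandwich)
    show "(\<lambda>n. L - C / real n) \<longlonglongrightarrow> L" "(\<lambda>n. L + C' / real n) \<longlonglongrightarrow> L"
      by (auto intro!: tendsto_eq_intros lim_const_over_n)
    have *: "L - C / real n = (L * real n - C) / real n" "L + C' / real n = (L * real n + C') / real n"
      if "n \<ge> 1" for n
      using that by (simp_all add: field_simps)
    show "\<forall>\<^sub>F n in sequentially.
        L - C / real n \<le> real (commutator_length G (g [^]\<^bsub>G\<^esub> n)) / real n"
      using assms(1) by (intro eventually_sequentiallyI[of 1]) (simp only: *, intro divide_right_mono, auto)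
    show "\<forall>\<^sub>F n in sequentially.
        real (commutator_length G (g [^]\<^bsub>G\<^esub> n)) / real n \<le> L + C' / real n"
      using assms(2) by (intro eventually_sequentiallyI[of 1]) (simp only: *, intro divide_right_mono, auto)
  qed
  then show ?thesis unfolding scl_def by (rule limI)
qed

section \<open>Odd functions with small defect on a group\<close>

text \<open>\<open>angle d i\<close> is meant as the value at \<open>x\<^sup>i\<close> for \<open>x\<close> of order \<open>d\<close>, where \<open>d = 0\<close> stands for
  infinite order: it is the sawtooth \<open>1 - 2t\<close> of the rotation number \<open>t = i/d\<close>. The bound
  \<open>1 - 2 / real d\<close> below is \<open>1\<close> for \<open>d = 0\<close>, because \<open>2 / 0 = 0\<close>.\<close>

definition angle :: "nat \<Rightarrow> int \<Rightarrow> real" where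
  "angle d i = (if int d dvd i then 0 else if d = 0 then sgn (of_int i)
     else 1 - 2 * of_int (i mod int d) / real d)"

lemma angle_1:
  assumes "d \<noteq> 1" shows "angle d 1 = 1 - 2 / real d"
  using assms by (cases "d = 0") (auto simp: angle_def)

text \<open>Makes \<open>angle\<close> well defined on the powers of an element, whose exponent is
  known only modulo the order.\<close>

lemma angle_cong: "int d dvd j - i \<Longrightarrow> angle d i = angle d j"
proof -
  assume d: "int d dvd j - i"
  then have "i mod int d = j mod int d" by (metis mod_eq_dvd_iff)
  moreover from this have "int d dvd i \<longleftrightarrow> int d dvd j" by (metis dvd_eq_mod_eq_0)
  moreover have "d = 0 \<Longrightarrow> i = j" using d by simp
  ultimately show ?thesis by (auto simp: angle_def)
qed

lemma mod_bounds:
  assumes "d > 0" "\<not> int d dvd i"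
  shows "1 \<le> i mod int d" "i mod int d \<le> int d - 1"
proof -
  have "i mod int d \<noteq> 0" "0 \<le> i mod int d" "i mod int d < int d"
    using assms by (auto simp: dvd_eq_mod_eq_0)
  then show "1 \<le> i mod int d" "i mod int d \<le> int d - 1" by linarith+
qed

text \<open>The sawtooth is extreme at the residues \<open>1\<close> and \<open>d - 1\<close>. For
  \<open>d = 1\<close> the bound would be negative.\<close>

lemma abs_angle_le:
  assumes "d \<noteq> 1" shows "\<bar>angle d i\<bar> \<le> 1 - 2 / real d"
proof (cases "d = 0 \<or> int d dvd i")
  case True
  then show ?thesis using assms by (auto simp: angle_def sgn_if field_simps)
next
  case False
  then have d: "d > 0" and b: "1 \<le> real_of_int (i mod int d)" "real_of_int (i mod int d) \<le> real d - 1"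
    using mod_bounds[of d i] by linarith+
  have "angle d i = 1 - 2 * (real_of_int (i mod int d) / real d)"
    using False by (simp add: angle_def)
  moreover have "1 / real d \<le> real_of_int (i mod int d) / real d"
    "real_of_int (i mod int d) / real d \<le> 1 - 1 / real d"
    using d b by (simp_all add: field_simps)
  ultimately show ?thesis by (simp add: abs_le_iff)
qed

lemma angle_minus: "angle d (- i) = - angle d i"
proof (cases "d = 0 \<or> int d dvd i")
  case True
  then show ?thesis by (auto simp: angle_def sgn_if)
next
  case False
  then have "(- i) mod int d = int d - i mod int d"
    by (simp add: zmod_zminus1_eq_if dvd_eq_mod_eq_0)
  then have "real_of_int ((- i) mod int d) = real d - real_of_int (i mod int d)" by simp
  then show ?thesis using False by (simp add: angle_def diff_divide_distrib)
qed

text \<open>The bound is attained: for \<open>d > 0\<close> the terms inside the absolute values have the same sign and add up to \<open>\<plusminus>2\<close>.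
  This is what makes the defect below optimal.\<close>

lemma angle_tripod:
  assumes "\<not> int d dvd i" "\<not> int d dvd j" "\<not> int d dvd i + j"
  shows "\<bar>angle d i - angle d (i + j)\<bar> + \<bar>angle d i + angle d j\<bar> + \<bar>angle d j - angle d (i + j)\<bar> \<le> 2"
proof (cases "d = 0")
  case True
  then show ?thesis using assms by (auto simp: angle_def sgn_if)
next
  case False
  define p q where "p = i mod int d" and "q = j mod int d"
  have p: "1 \<le> p" "p \<le> int d - 1" and q: "1 \<le> q" "q \<le> int d - 1"
    using mod_bounds assms False by (auto simp: p_def q_def)
  define P Q where "P = real_of_int p / real d" and "Q = real_of_int q / real d"
  have PQ: "0 \<le> P" "P \<le> 1" "0 \<le> Q" "Q \<le> 1" using p q by (simp_all add: P_def Q_def)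
  have m: "(i + j) mod int d = (p + q) mod int d" by (simp add: p_def q_def mod_simps)
  then have "p + q \<noteq> int d" using assms(3) by (auto simp: dvd_eq_mod_eq_0)
  \<comment> \<open>Without a carry the three terms are \<open>2 * Q\<close>,
    \<open>2 - 2 * P - 2 * Q\<close>, \<open>2 * P\<close>; with a carry the outer two drop by 2 and
    all three are nonpositive.\<close>
  then consider "p + q < int d" | "int d < p + q" by linarith
  then show ?thesis
  proof cases
    case 1
    then have "(i + j) mod int d = p + q" using m p q by simp
    then have a: "angle d i = 1 - 2 * P" "angle d j = 1 - 2 * Q" "angle d (i + j) = 1 - 2 * P - 2 * Q"
      using assms False by (simp_all add: angle_def P_def Q_def p_def q_def diff_divide_distrib add_divide_distrib)
    have "P + Q \<le> 1" using 1 False by (simp add: P_def Q_def flip: add_divide_distrib)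
    then show ?thesis using PQ unfolding a by linarith
  next
    case 2
    have "(p + q) mod int d = (p + q - int d) mod int d" by simp
    also have "\<dots> = p + q - int d" using p q 2 by (intro mod_pos_pos_trivial) auto
    finally have "(i + j) mod int d = p + q - int d" using m by simp
    then have a: "angle d i = 1 - 2 * P" "angle d j = 1 - 2 * Q" "angle d (i + j) = 3 - 2 * P - 2 * Q"
      using assms False by (simp_all add: angle_def P_def Q_def p_def q_def diff_divide_distrib add_divide_distrib)
    have "1 \<le> P + Q" using 2 False by (simp add: P_def Q_def flip: add_divide_distrib)
    then show ?thesis using PQ unfolding a by linarith
  qed
qed

text \<open>The function is \<open>angle\<close> on the cyclic subgroup generated by
  \<open>x\<close> and 0 elsewhere. The last property carries \<open>angle_tripod\<close> over to
  the whole group.\<close>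

lemma (in group) ex_angle_function:
  assumes x: "x \<in> carrier G" "x \<noteq> \<one>"
  obtains s where "s x = 1 - 2 / real (ord x)"
    and "\<And>y. \<bar>s y\<bar> \<le> 1 - 2 / real (ord x)"
    and "\<And>y. y \<in> carrier G \<Longrightarrow> s (inv y) = - s y"
    and "\<And>y z. \<lbrakk>y \<in> carrier G - {\<one>}; z \<in> carrier G - {\<one>}; y \<otimes> z \<noteq> \<one>\<rbrakk> \<Longrightarrow>
           \<bar>s y - s (y \<otimes> z)\<bar> + \<bar>s y + s z\<bar> + \<bar>s z - s (y \<otimes> z)\<bar> \<le> 2"
proof -
  define d where "d = ord x"
  have d1: "d \<noteq> 1" using x ord_eq_1 by (simp add: d_def)
  define P where "P = range (\<lambda>i::int. x [^] i)"
  define s where "s y = (if y \<in> P then angle d (SOME i. y = x [^] i) else 0)" for y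
  have s_pow: "s (x [^] i) = angle d i" for i :: int
  proof -
    have "x [^] i = x [^] (SOME j::int. x [^] i = x [^] j)" by (rule someI) (rule refl)
    then have "int d dvd (SOME j::int. x [^] i = x [^] j) - i"
      using x by (simp add: int_pow_eq d_def)
    from angle_cong[OF this] show ?thesis by (simp add: s_def P_def)
  qed
  have s_out: "s y = 0" if "y \<notin> P" for y using that by (simp add: s_def)
  have P_mult: "y \<otimes> z \<in> P" if "y \<in> P" "z \<in> P" for y z
    using that x by (auto simp: P_def simp flip: int_pow_mult)
  have P_inv: "inv y \<in> P" if "y \<in> P" for y
    using that x by (auto simp: P_def simp flip: int_pow_neg)
  \<comment> \<open>The instance at \<open>0\<close> says that the bound is nonnegative, which
    covers the elements outside \<open>P\<close>.\<close>
  have bound: "\<bar>s y\<bar> \<le> 1 - 2 / real d" for y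
    unfolding s_def using abs_angle_le[OF d1] abs_angle_le[OF d1, of 0] by (auto simp: angle_def)
  have b1: "\<bar>s y\<bar> \<le> 1" for y using bound[of y] by (rule order_trans) simp
  show thesis
  proof (rule that[of s])
    show "s x = 1 - 2 / real (ord x)"
      using s_pow[of 1] angle_1[OF d1] x by (simp add: d_def)
    show "\<bar>s y\<bar> \<le> 1 - 2 / real (ord x)" for y using bound by (simp add: d_def)
    show "s (inv y) = - s y" if y: "y \<in> carrier G" for y
    proof (cases "y \<in> P")
      case True
      then obtain i :: int where i: "y = x [^] i" by (auto simp: P_def)
      then show ?thesis using s_pow[of i] s_pow[of "- i"] x by (simp add: int_pow_neg angle_minus)
    next
      case False
      then have "inv y \<notin> P" using P_inv[of "inv y"] y by auto
      then show ?thesis using False by (simp add: s_out)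
    qed
    fix y z assume yz: "y \<in> carrier G - {\<one>}" "z \<in> carrier G - {\<one>}" and n: "y \<otimes> z \<noteq> \<one>"
    have yP: "y \<in> P" if "z \<in> P" "y \<otimes> z \<in> P"
      using P_mult[OF that(2) P_inv[OF that(1)]] yz by (simp add: m_assoc)
    have zP: "z \<in> P" if "y \<in> P" "y \<otimes> z \<in> P"
      using P_mult[OF P_inv[OF that(1)] that(2)] yz by (simp add: m_assoc[symmetric])
    show "\<bar>s y - s (y \<otimes> z)\<bar> + \<bar>s y + s z\<bar> + \<bar>s z - s (y \<otimes> z)\<bar> \<le> 2"
    proof (cases "y \<in> P \<and> z \<in> P")
      case True
      then obtain i j :: int where ij: "y = x [^] i" "z = x [^] j" by (auto simp: P_def)
      then have yz_ij: "y \<otimes> z = x [^] (i + j)" using x by (simp add: int_pow_mult)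
      have "\<not> int d dvd i" "\<not> int d dvd j" "\<not> int d dvd i + j"
        using yz n x unfolding yz_ij unfolding ij d_def by (auto simp flip: int_pow_eq_id)
      from angle_tripod[OF this] show ?thesis unfolding yz_ij unfolding ij s_pow .
    next
      case False
      \<comment> \<open>As \<open>P\<close> is a subgroup, at most one of the three elements lies in
        it, and its value occurs in just two of the terms.\<close>
      then have "y \<notin> P \<and> z \<notin> P \<or> y \<notin> P \<and> y \<otimes> z \<notin> P \<or> z \<notin> P \<and> y \<otimes> z \<notin> P"
        using yP zP by blast
      then show ?thesis using b1[of y] b1[of z] b1[of "y \<otimes> z"] by (auto simp: s_out)
    qed
  qed
qed

section \<open>Cancellation in free products\<close>

definition inv_letter ::
  "('a, 'm) monoid_scheme \<Rightarrow> ('b, 'n) monoid_scheme \<Rightarrow> 'a + 'b \<Rightarrow> 'a + 'b" where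
  "inv_letter A B = map_sum (m_inv A) (m_inv B)"

definition inv_word ::
  "('a, 'm) monoid_scheme \<Rightarrow> ('b, 'n) monoid_scheme \<Rightarrow> ('a + 'b) list \<Rightarrow> ('a + 'b) list" where
  "inv_word A B w = map (inv_letter A B) (rev w)"

lemma reduced_words_append:
  "u @ v \<in> reduced_words A B \<longleftrightarrow> u \<in> reduced_words A B \<and> v \<in> reduced_words A B \<and>
     (u = [] \<or> v = [] \<or> isl (last u) \<noteq> isl (hd v))"
  by (auto simp: reduced_words_def successively_append_iff)

lemma inv_word_simps [simp]:
  "inv_word A B [] = []"
  "inv_word A B (w @ [l]) = inv_letter A B l # inv_word A B w"
  "inv_word A B (l # w) = inv_word A B w @ [inv_letter A B l]"
  by (simp_all add: inv_word_def)

lemma inv_word_eq_Nil [simp]: "inv_word A B w = [] \<longleftrightarrow> w = []"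
  by (simp add: inv_word_def)

lemma isl_inv_letter [simp]: "isl (inv_letter A B l) = isl l"
  by (cases l) (simp_all add: inv_letter_def)

lemma last_inv_word: "w \<noteq> [] \<Longrightarrow> last (inv_word A B w) = inv_letter A B (hd w)"
  by (simp add: inv_word_def last_map last_rev)

lemma push_merge:
  assumes "isl l = isl m"
  shows "push A B l (m # w) = push A B l [m] @ w"
  using assms by (cases l; cases m) auto

locale free_product_groups =
  fixes A :: "('a, 'm) monoid_scheme" and B :: "('b, 'n) monoid_scheme"
  assumes A: "group A" and B: "group B"
begin

sublocale A: group A by (rule A)
sublocale B: group B by (rule B)

sublocale FP: group "free_product A B"
  using A B by (rule group_free_product)

lemma inv_letter_in_letters: "l \<in> letters A B \<Longrightarrow> inv_letter A B l \<in> letters A B"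
  using A.inv_eq_1_iff B.inv_eq_1_iff by (auto simp: letters_def inv_letter_def)

lemma inv_word_reduced: "w \<in> reduced_words A B \<Longrightarrow> inv_word A B w \<in> reduced_words A B"
  by (induction w)
    (auto simp: reduced_words_Cons reduced_words_append inv_letter_in_letters last_inv_word)

lemma push_inv_letter: "l \<in> letters A B \<Longrightarrow> push A B (inv_letter A B l) [l] = []"
  by (cases l) (auto simp: letters_def inv_letter_def)

lemma push_Nil_iff:
  assumes "l \<in> letters A B" "m \<in> letters A B"
  shows "push A B l [m] = [] \<longleftrightarrow> m = inv_letter A B l"
  using assms
  by (cases l; cases m)
    (auto simp: letters_def inv_letter_def dest: A.inv_equality B.inv_equality A.inv_comm B.inv_comm)

lemma foldr_push_append: "u @ v \<in> reduced_words A B \<Longrightarrow> foldr (push A B) u v = u @ v"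
  by (induction u) (auto simp: reduced_words_Cons push_Cons[OF A B])

lemma inv_word_is_inv:
  assumes "w \<in> reduced_words A B"
  shows "inv\<^bsub>free_product A B\<^esub> w = inv_word A B w"
proof (rule FP.inv_equality)
  have "foldr (push A B) (inv_word A B w) w = []"
    using assms
  proof (induction w)
    case (Cons l w)
    then have l: "l \<in> letters A B" and w: "w \<in> reduced_words A B"
      and r: "w = [] \<or> isl l \<noteq> isl (hd w)" by (auto simp: reduced_words_Cons)
    have "push A B (inv_letter A B l) (l # w) = w"
      using push_inv_letter[OF l] push_merge[of "inv_letter A B l" l A B w] by simp
    then show ?case using Cons.IH[OF w] by simp
  qed simp
  then show "inv_word A B w \<otimes>\<^bsub>free_product A B\<^esub> w = \<one>\<^bsub>free_product A B\<^esub>"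
    by (simp add: free_product_def)
qed (use assms inv_word_reduced in \<open>simp_all add: free_product_def\<close>)

text \<open>\<open>Q\<close> is the part of \<open>x\<close> that cancels against \<open>y\<close>.
  The letters \<open>last P\<close> and \<open>hd R\<close> that then meet may still lie in one
  factor and merge, but not to the identity.\<close>

lemma maximal_cancellation:
  assumes "x \<in> reduced_words A B" "y \<in> reduced_words A B"
  obtains P Q R where "x = P @ Q" "y = inv_word A B Q @ R"
    "foldr (push A B) x y = foldr (push A B) P R"
    "P = [] \<or> R = [] \<or> push A B (last P) [hd R] \<noteq> []"
proof -
  have "\<exists>P Q R. x = P @ Q \<and> y = inv_word A B Q @ R \<and>
      foldr (push A B) x y = foldr (push A B) P R \<and>
      (P = [] \<or> R = [] \<or> push A B (last P) [hd R] \<noteq> [])"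
    using assms
  \<comment> \<open>Cancellation begins at the last letter of \<open>x\<close>, hence the induction
    from the right.\<close>
  proof (induction x arbitrary: y rule: rev_induct)
    case Nil
    show ?case by (intro exI[of _ "[]"] exI[of _ y]) simp
  next
    case (snoc l x)
    show ?case
    proof (cases "y = [] \<or> push A B l [hd y] \<noteq> []")
      case True
      show ?thesis
        by (rule exI[of _ "x @ [l]"], rule exI[of _ "[]"], rule exI[of _ y]) (use True in auto)
    next
      case False
      then obtain m v where y: "y = m # v" and pm: "push A B l [m] = []" by (cases y) auto
      have lm: "l \<in> letters A B" "m \<in> letters A B" and x: "x \<in> reduced_words A B"
        and v: "v \<in> reduced_words A B"
        using snoc.prems by (auto simp: y reduced_words_Cons reduced_words_append)
      have m: "m = inv_letter A B l" using pm push_Nil_iff[OF lm] by simp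
      then have lv: "push A B l y = v"
        using push_merge[of l m A B v] pm by (simp add: y)
      obtain P Q R where PQR: "x = P @ Q" "v = inv_word A B Q @ R"
        "foldr (push A B) x v = foldr (push A B) P R"
        "P = [] \<or> R = [] \<or> push A B (last P) [hd R] \<noteq> []"
        using snoc.IH[OF x v] by blast
      show ?thesis
        by (rule exI[of _ P], rule exI[of _ "Q @ [l]"], rule exI[of _ R])
          (use PQR lv in \<open>auto simp: y m\<close>)
    qed
  qed
  then show thesis using that by blast
qed

end

section \<open>A turning quasimorphism\<close>

text \<open>The sign depends on whether the path turns from the first factor into the second or back; it
  makes the value change sign under inversion of the two-letter word.\<close>

definition junction :: "('a + 'b \<Rightarrow> real) \<Rightarrow> 'a + 'b \<Rightarrow> 'a + 'b \<Rightarrow> real" where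
  "junction s l m = (if isl l then 1 else - 1) * s l * s m"

fun turning :: "('a + 'b \<Rightarrow> real) \<Rightarrow> ('a + 'b) list \<Rightarrow> real" where
  "turning s (l # m # w) = junction s l m + turning s (m # w)"
| "turning s _ = 0"

text \<open>The default 0 makes the boundary terms in \<open>turning_defect\<close> uniform when a
  neighbouring word is empty.\<close>

definition end_value :: "('a + 'b \<Rightarrow> real) \<Rightarrow> ('a + 'b) list \<Rightarrow> real" where
  "end_value s w = (if w = [] then 0 else s (last w))"

definition start_value :: "('a + 'b \<Rightarrow> real) \<Rightarrow> ('a + 'b) list \<Rightarrow> real" where
  "start_value s w = (if w = [] then 0 else s (hd w))"

lemma turning_Cons: "turning s (l # w) = (if w = [] then 0 else junction s l (hd w)) + turning s w"
  by (cases w) simp_all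

lemma turning_append:
  "turning s (u @ v) =
     turning s u + (if u = [] \<or> v = [] then 0 else junction s (last u) (hd v)) + turning s v"
  by (induction u) (auto simp: turning_Cons)

text \<open>\<open>s_tripod\<close> is about two letters of one factor that merge into
  \<open>t\<close>. By \<open>M \<le> 1\<close>, a product of two values of \<open>s\<close> on
  letters has absolute value at most \<open>M\<close>.\<close>

locale turning_quasimorphism = free_product_groups A B
  for A :: "('a, 'm) monoid_scheme" and B :: "('b, 'n) monoid_scheme" +
  fixes s :: "'a + 'b \<Rightarrow> real" and M :: real
  assumes s_inv: "l \<in> letters A B \<Longrightarrow> s (inv_letter A B l) = - s l"
    and s_bound: "l \<in> letters A B \<Longrightarrow> \<bar>s l\<bar> \<le> M"
    and M: "0 \<le> M" "M \<le> 1"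
    and s_tripod: "\<lbrakk>l \<in> letters A B; m \<in> letters A B; isl l = isl m; push A B l [m] = [t]\<rbrakk> \<Longrightarrow>
      \<bar>s l - s t\<bar> + \<bar>s l + s m\<bar> + \<bar>s m - s t\<bar> \<le> 2"
begin

text \<open>In \<open>junction\<close> the two signs from \<open>s_inv\<close> cancel, while
  reversing the order of two alternating letters flips the direction sign.\<close>

lemma turning_inv_word:
  "w \<in> reduced_words A B \<Longrightarrow> turning s (inv_word A B w) = - turning s w"
proof (induction w)
  case (Cons l w)
  then have w: "w \<in> reduced_words A B" and l: "l \<in> letters A B"
    and lw: "w \<noteq> [] \<Longrightarrow> isl l \<noteq> isl (hd w)" by (auto simp: reduced_words_Cons)
  have "w \<noteq> [] \<Longrightarrow> hd w \<in> letters A B" using w by (cases w) (auto simp: reduced_words_Cons)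
  then show ?case
    using Cons.IH[OF w] l lw
    by (auto simp: turning_append turning_Cons last_inv_word junction_def s_inv)
qed simp

lemma junction_le:
  assumes "l \<in> letters A B" "m \<in> letters A B"
  shows "\<bar>junction s l m\<bar> \<le> M"
proof -
  have "\<bar>s l\<bar> * \<bar>s m\<bar> \<le> M * 1" using s_bound assms M by (intro mult_mono) force+
  then show ?thesis by (simp add: junction_def abs_mult)
qed

lemma last_in_letters: "w \<in> reduced_words A B \<Longrightarrow> w \<noteq> [] \<Longrightarrow> last w \<in> letters A B"
  unfolding reduced_words_def using last_in_set by blast

lemma hd_in_letters: "w \<in> reduced_words A B \<Longrightarrow> w \<noteq> [] \<Longrightarrow> hd w \<in> letters A B"
  unfolding reduced_words_def using hd_in_set by blast

text \<open>The cancelled part \<open>Q\<close> contributes opposite amounts to \<open>x\<close> and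
  \<open>y\<close>, so only junctions at the cut matter. Without a merge at most one is left. In a
  merge, three neighbours of weight at most \<open>M\<close> multiply the differences in
  \<open>s_tripod\<close>, whose sum is at most 2.\<close>

lemma turning_defect:
  assumes x: "x \<in> reduced_words A B" and y: "y \<in> reduced_words A B"
  shows "\<bar>turning s (foldr (push A B) x y) - turning s x - turning s y\<bar> \<le> 2 * M"
proof -
  obtain P Q R where PQR: "x = P @ Q" "y = inv_word A B Q @ R"
    and prod: "foldr (push A B) x y = foldr (push A B) P R"
    and max: "P = [] \<or> R = [] \<or> push A B (last P) [hd R] \<noteq> []"
    using maximal_cancellation[OF x y] by blast
  have red: "P \<in> reduced_words A B" "Q \<in> reduced_words A B" "R \<in> reduced_words A B"
    using x y by (simp_all add: PQR reduced_words_append)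
  have jPQ: "P \<noteq> [] \<Longrightarrow> Q \<noteq> [] \<Longrightarrow> isl (last P) \<noteq> isl (hd Q)"
    and jQR: "R \<noteq> [] \<Longrightarrow> Q \<noteq> [] \<Longrightarrow> isl (hd Q) \<noteq> isl (hd R)"
    using x y by (auto simp: PQR reduced_words_append last_inv_word)
  have tx: "turning s x = turning s P + (if P = [] \<or> Q = [] then 0 else junction s (last P) (hd Q)) + turning s Q"
    by (simp add: PQR turning_append)
  have ty: "turning s y = - turning s Q
      + (if R = [] \<or> Q = [] then 0 else junction s (inv_letter A B (hd Q)) (hd R)) + turning s R"
    using red by (simp add: PQR turning_append turning_inv_word last_inv_word)
  have iQ: "Q \<noteq> [] \<Longrightarrow> inv_letter A B (hd Q) \<in> letters A B"
    using hd_in_letters red inv_letter_in_letters by blast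
  consider (empty) "P = [] \<or> R = []"
    | (concat) "P \<noteq> []" "R \<noteq> []" "isl (last P) \<noteq> isl (hd R)"
    | (merge) "P \<noteq> []" "R \<noteq> []" "isl (last P) = isl (hd R)" by blast
  then show ?thesis
  proof cases
    case empty
    have j: "\<bar>if R = [] \<or> Q = [] then 0 else junction s (inv_letter A B (hd Q)) (hd R)\<bar> \<le> M"
      "\<bar>if P = [] \<or> Q = [] then 0 else junction s (last P) (hd Q)\<bar> \<le> M"
      using junction_le hd_in_letters last_in_letters red M iQ by auto
    have "foldr (push A B) P R = P @ R" using empty red foldr_push_append[of P R] by auto
    then show ?thesis
      using empty j M unfolding prod tx ty by auto
  next
    case concat
    \<comment> \<open>Otherwise \<open>last P\<close> and \<open>hd R\<close> would both lie in the
      factor opposite to \<open>hd Q\<close>, hence in the same one.\<close>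
    then have Q: "Q = []" using jPQ jQR by auto
    have "P @ R \<in> reduced_words A B" using red concat by (simp add: reduced_words_append)
    then have "foldr (push A B) P R = P @ R" by (rule foldr_push_append)
    moreover have "\<bar>junction s (last P) (hd R)\<bar> \<le> M"
      using junction_le hd_in_letters last_in_letters red concat by blast
    ultimately show ?thesis using concat M unfolding prod tx ty Q by (simp add: turning_append)
  next
    case merge
    obtain P' l where P: "P = P' @ [l]" using merge(1) by (cases P rule: rev_cases) auto
    obtain m R' where R: "R = m # R'" using merge(2) by (cases R) auto
    have lm: "l \<in> letters A B" "m \<in> letters A B" "isl l = isl m"
      using red merge(3) by (auto simp: P R reduced_words_append reduced_words_Cons)
    \<comment> \<open>\<open>max\<close> excludes that \<open>l\<close> and \<open>m\<close>
      multiply to the identity, so a merged letter exists.\<close>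
    obtain t where t: "push A B l [m] = [t]" "isl t = isl l"
      using max lm(3) by (cases l; cases m) (auto simp: P R split: if_splits)
    have tl: "t \<in> letters A B"
      using push_closed[OF A B letters_all[OF lm(1)], of "[m]"] lm(2) t
      by (simp add: reduced_words_Cons)
    have "P' @ t # R' \<in> reduced_words A B"
      using red lm(3) t(2) tl by (auto simp: P R reduced_words_append reduced_words_Cons)
    then have prod': "foldr (push A B) P R = P' @ t # R'"
      using foldr_push_append[of P' "t # R'"] push_merge[OF lm(3), of A B R'] t(1) by (simp add: P R)
    define \<epsilon> :: real where "\<epsilon> = (if isl l then 1 else - 1)"
    \<comment> \<open>The values next to the merge: before \<open>l\<close>, at the start of the
      cancelled part, and after \<open>m\<close>. These letters lie in the other factor, hence the
      common sign \<open>\<epsilon>\<close>.\<close>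
    define p q r where "p = end_value s P'" and "q = start_value s Q" and "r = start_value s R'"
    have jP: "(if P' = [] then 0 else junction s (last P') k) = - \<epsilon> * p * s k" for k
      using red by (auto simp: P reduced_words_append \<epsilon>_def p_def end_value_def junction_def)
    have jl: "(if Q = [] then 0 else junction s l (hd Q)) = \<epsilon> * s l * q"
      by (simp add: \<epsilon>_def q_def start_value_def junction_def)
    have jQ: "(if Q = [] then 0 else junction s (inv_letter A B (hd Q)) m) = \<epsilon> * q * s m"
      using jQR red hd_in_letters lm(3)
      by (auto simp: \<epsilon>_def q_def start_value_def junction_def s_inv R)
    have jR: "(if R' = [] then 0 else junction s k (hd R')) = \<epsilon> * s k * r" if "isl k = isl l" for k
      using that by (simp add: \<epsilon>_def r_def start_value_def junction_def)
    have "turning s (foldr (push A B) x y) - turning s x - turning s y =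
        \<epsilon> * (p * (s l - s t) - q * (s l + s m) - r * (s m - s t))"
    proof -
      have "turning s P = turning s P' - \<epsilon> * p * s l"
        using jP[of l] by (cases "P' = []") (simp_all add: P turning_append)
      moreover have "turning s R = \<epsilon> * s m * r + turning s R'"
        using jR[of m] lm(3) by (cases "R' = []") (simp_all add: R turning_Cons)
      moreover have "turning s (P' @ t # R') = turning s P' - \<epsilon> * p * s t + \<epsilon> * s t * r + turning s R'"
        using jP[of t] jR[of t] t(2)
        by (cases "P' = []"; cases "R' = []") (auto simp: turning_append turning_Cons)
      moreover have "turning s x = turning s P + \<epsilon> * s l * q + turning s Q"
        using jl by (cases "Q = []") (simp_all add: tx P)
      moreover have "turning s y = - turning s Q + \<epsilon> * q * s m + turning s R"
        using jQ by (cases "Q = []") (simp_all add: ty R)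
      ultimately show ?thesis unfolding prod prod' by (simp add: algebra_simps)
    qed
    also have "\<bar>\<dots>\<bar> = \<bar>p * (s l - s t) - q * (s l + s m) - r * (s m - s t)\<bar>"
      by (simp add: \<epsilon>_def abs_mult)
    also have "\<dots> \<le> \<bar>p\<bar> * \<bar>s l - s t\<bar> + \<bar>q\<bar> * \<bar>s l + s m\<bar> + \<bar>r\<bar> * \<bar>s m - s t\<bar>"
      unfolding abs_mult[symmetric] by linarith
    also have "\<dots> \<le> M * \<bar>s l - s t\<bar> + M * \<bar>s l + s m\<bar> + M * \<bar>s m - s t\<bar>"
      using red M
      by (intro add_mono mult_right_mono)
        (auto simp: p_def q_def r_def end_value_def start_value_def P R reduced_words_append
          reduced_words_Cons intro!: s_bound last_in_letters hd_in_letters)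
    also have "\<dots> = M * (\<bar>s l - s t\<bar> + \<bar>s l + s m\<bar> + \<bar>s m - s t\<bar>)" by (simp add: algebra_simps)
    also have "\<dots> \<le> M * 2" using s_tripod[OF lm t(1)] M by (intro mult_left_mono) auto
    finally show ?thesis by simp
  qed
qed

end

section \<open>The value of scl\<close>

context group
begin

section \<open>Upper bounds on the commutator length of powers, from either order\<close>

lemma commutator_length_inv_le:
  assumes "x \<in> commutator_products G n"
  shows "commutator_length G (inv x) \<le> commutator_length G x"
  by (intro commutator_length_le commutator_products_inv commutator_length_attained[OF assms])

lemma commutator_pow_in_products:
  "\<lbrakk>a \<in> carrier G; b \<in> carrier G\<rbrakk> \<Longrightarrow> commutator G a b [^] (n::nat) \<in> commutator_products G n"
  using commutator_products_pow[OF commutator_in_products, of a b n] by simp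

lemma commutator_length_commutator_pow_le:
  assumes a: "a \<in> carrier G" "a \<noteq> \<one>" and b: "b \<in> carrier G"
  shows "\<exists>C. \<forall>n. real (commutator_length G (commutator G a b [^] n))
           \<le> (1 / 2 - 1 / real (ord a)) * real n + C"
\<comment> \<open>Infinite order is \<open>ord a = 0\<close>, where \<open>1 / real 0 = 0\<close>
  gives slope 1/2, from period 2. Finite order \<open>k\<close> uses period
  \<open>2 * k\<close>.\<close>
proof (cases "ord a = 0")
  case True
  have "real (commutator_length G (commutator G a b [^] n)) \<le> real 1 / real 2 * real n + real (1 + 2)" for n
    using commutator_pow_infinite[OF a(1) b] a b
    by (intro commutator_length_pow_le commutator_in_products) (simp_all add: mult.commute)
  then show ?thesis using True by auto
next
  case False
  define k where "k = ord a"
  have k: "k \<ge> 2" using False a ord_eq_1[of a] unfolding k_def by linarith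
  have *: "commutator G a b [^] (n * (2 * k)) \<in> commutator_products G (n * (k - 2) + (k - 1))" for n
  proof -
    have "2 * n * k = n * (2 * k)" "1 + (k - 2) * (n + 1) = n * (k - 2) + (k - 1)"
      using k by (auto simp: algebra_simps dest!: le_Suc_ex)
    then show ?thesis
      using commutator_pow_finite[OF a(1) b _ k, of n] a by (metis k_def pow_ord_eq_1)
  qed
  have "real (commutator_length G (commutator G a b [^] n))
      \<le> real (k - 2) / real (2 * k) * real n + real (k - 1 + 2 * k)" for n
    using k a b * by (intro commutator_length_pow_le commutator_in_products) simp_all
  moreover have "real (k - 2) / real (2 * k) = 1 / 2 - 1 / real (ord a)"
    using k by (simp add: of_nat_diff field_simps flip: k_def)
  ultimately show ?thesis by metis
qed

text \<open>The roles of \<open>a\<close> and \<open>b\<close> can be exchanged because the inverse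
  of \<open>commutator G a b\<close> is \<open>commutator G b a\<close>.\<close>

lemma commutator_length_commutator_pow_le':
  assumes a: "a \<in> carrier G" and b: "b \<in> carrier G" "b \<noteq> \<one>"
  shows "\<exists>C. \<forall>n. real (commutator_length G (commutator G a b [^] n))
           \<le> (1 / 2 - 1 / real (ord b)) * real n + C"
proof -
  have "commutator_length G (commutator G a b [^] n) \<le> commutator_length G (commutator G b a [^] n)" for n :: nat
    using commutator_length_inv_le[OF commutator_pow_in_products[OF b(1) a, of n]] a b
    by (simp add: inv_commutator flip: nat_pow_inv)
  then show ?thesis
    using commutator_length_commutator_pow_le[OF b a] by (meson of_nat_le_iff order_trans)
qed

end

section \<open>Lower bound in the free product, from the turning quasimorphism\<close>

lemma (in free_product_groups) commutator_word:
  assumes "a \<in> carrier A - {\<one>\<^bsub>A\<^esub>}" "b \<in> carrier B - {\<one>\<^bsub>B\<^esub>}"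
  shows "commutator (free_product A B) (fp_inl A a) (fp_inr B b) =
    [Inl a, Inr b, Inl (inv\<^bsub>A\<^esub> a), Inr (inv\<^bsub>B\<^esub> b)]"
proof -
  have r: "[Inl a] \<in> reduced_words A B" "[Inr b] \<in> reduced_words A B"
    using assms by (auto simp: reduced_words_Cons letters_def)
  have "inv\<^bsub>A\<^esub> a \<noteq> \<one>\<^bsub>A\<^esub>" "inv\<^bsub>B\<^esub> b \<noteq> \<one>\<^bsub>B\<^esub>"
    using assms A.inv_eq_1_iff B.inv_eq_1_iff by auto
  then show ?thesis
    using assms
    by (simp add: commutator_def fp_inl_def fp_inr_def inv_word_is_inv[OF r(1)] inv_word_is_inv[OF r(2)]
        inv_letter_def) (simp add: free_product_def)
qed

text \<open>Every adjacent pair contributes the same amount, as direction signs and inverses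
  compensate. \<open>Suc n\<close> avoids the empty word, where the count of pairs would be
  -1.\<close>

lemma (in turning_quasimorphism) turning_commutator_pow:
  assumes a: "a \<in> carrier A - {\<one>\<^bsub>A\<^esub>}" and b: "b \<in> carrier B - {\<one>\<^bsub>B\<^esub>}"
  shows "turning s (commutator (free_product A B) (fp_inl A a) (fp_inr B b) [^]\<^bsub>free_product A B\<^esub> Suc n)
    = (4 * real n + 3) * (s (Inl a) * s (Inr b))"
proof -
  define w where "w = [Inl a, Inr b, Inl (inv\<^bsub>A\<^esub> a), Inr (inv\<^bsub>B\<^esub> b)]"
  have sl: "s (Inl (inv\<^bsub>A\<^esub> a)) = - s (Inl a)" "s (Inr (inv\<^bsub>B\<^esub> b)) = - s (Inr b)"
    using s_inv[of "Inl a"] s_inv[of "Inr b"] a b by (auto simp: letters_def inv_letter_def)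
  have w: "w \<in> reduced_words A B"
    using a b A.inv_eq_1_iff B.inv_eq_1_iff by (auto simp: w_def reduced_words_Cons letters_def)
  define v where "v n = w [^]\<^bsub>free_product A B\<^esub> Suc n" for n :: nat
  have "v n \<in> reduced_words A B \<and> v n \<noteq> [] \<and> last (v n) = Inr (inv\<^bsub>B\<^esub> b) \<and>
      turning s (v n) = (4 * real n + 3) * (s (Inl a) * s (Inr b))"
  proof (induction n)
    case 0
    have "v 0 = w" using w by (simp add: v_def free_product_def)
    then show ?case using w by (simp add: w_def sl junction_def)
  next
    case (Suc n)
    have "v n @ w \<in> reduced_words A B" using Suc w by (simp add: reduced_words_append w_def)
    then have "v (Suc n) = v n @ w"
      using foldr_push_append[of "v n" w] by (simp add: v_def free_product_def)
    then show ?case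
      using Suc \<open>v n @ w \<in> _\<close>
      by (simp add: w_def turning_append sl junction_def algebra_simps)
  qed
  then show ?thesis by (simp add: commutator_word[OF a b] v_def w_def)
qed

text \<open>Defect \<open>2 * M\<close> gives \<open>(4 * n - 1) * (p * q) \<le> 8 * M * c\<close>.
  Since \<open>M\<close> is the larger of \<open>p\<close> and \<open>q\<close>, dividing by it
  leaves the smaller one, \<open>2 * L\<close>.\<close>

lemma (in free_product_groups) commutator_length_commutator_pow_ge:
  assumes a: "a \<in> carrier A - {\<one>\<^bsub>A\<^esub>}" and b: "b \<in> carrier B - {\<one>\<^bsub>B\<^esub>}"
  defines "L \<equiv> min (1 / 2 - 1 / real (A.ord a)) (1 / 2 - 1 / real (B.ord b))"
  shows "L * real n - 1 \<le> real (commutator_length (free_product A B)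
      (commutator (free_product A B) (fp_inl A a) (fp_inr B b) [^]\<^bsub>free_product A B\<^esub> n))"
\<comment> \<open>\<open>L\<close> is nonpositive exactly when an order is 2, and then the claim is
  trivial. Otherwise \<open>M\<close> is positive and can be divided by.\<close>
proof (cases "n = 0 \<or> L \<le> 0")
  case True
  then have "L * real n \<le> 0" by (auto simp: mult_nonpos_nonneg)
  then show ?thesis by linarith
next
  case False
  then obtain m where n: "n = Suc m" by (cases n) auto
  define p q where "p = 1 - 2 / real (A.ord a)" and "q = 1 - 2 / real (B.ord b)"
  have L: "L = min p q / 2" by (auto simp: L_def p_def q_def min_def)
  then have pq: "0 < p" "0 < q" "p \<le> 1" "q \<le> 1" using False by (auto simp: p_def q_def)
  obtain s1 where s1: "s1 a = p" "\<And>y. \<bar>s1 y\<bar> \<le> p" "\<And>y. y \<in> carrier A \<Longrightarrow> s1 (inv\<^bsub>A\<^esub> y) = - s1 y"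
    "\<And>y z. \<lbrakk>y \<in> carrier A - {\<one>\<^bsub>A\<^esub>}; z \<in> carrier A - {\<one>\<^bsub>A\<^esub>}; y \<otimes>\<^bsub>A\<^esub> z \<noteq> \<one>\<^bsub>A\<^esub>\<rbrakk> \<Longrightarrow>
       \<bar>s1 y - s1 (y \<otimes>\<^bsub>A\<^esub> z)\<bar> + \<bar>s1 y + s1 z\<bar> + \<bar>s1 z - s1 (y \<otimes>\<^bsub>A\<^esub> z)\<bar> \<le> 2"
    using A.ex_angle_function[of a] a unfolding p_def by blast
  obtain s2 where s2: "s2 b = q" "\<And>y. \<bar>s2 y\<bar> \<le> q" "\<And>y. y \<in> carrier B \<Longrightarrow> s2 (inv\<^bsub>B\<^esub> y) = - s2 y"
    "\<And>y z. \<lbrakk>y \<in> carrier B - {\<one>\<^bsub>B\<^esub>}; z \<in> carrier B - {\<one>\<^bsub>B\<^esub>}; y \<otimes>\<^bsub>B\<^esub> z \<noteq> \<one>\<^bsub>B\<^esub>\<rbrakk> \<Longrightarrow>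
       \<bar>s2 y - s2 (y \<otimes>\<^bsub>B\<^esub> z)\<bar> + \<bar>s2 y + s2 z\<bar> + \<bar>s2 z - s2 (y \<otimes>\<^bsub>B\<^esub> z)\<bar> \<le> 2"
    using B.ex_angle_function[of b] b unfolding q_def by blast
  define s where "s = case_sum s1 s2"
  define M where "M = max p q"
  interpret turning_quasimorphism A B s M
  proof unfold_locales
    show "s (inv_letter A B l) = - s l" if "l \<in> letters A B" for l
      using that s1(3) s2(3) by (auto simp: letters_def s_def inv_letter_def)
    show "\<bar>s l\<bar> \<le> M" if "l \<in> letters A B" for l
      using s1(2) s2(2) by (cases l) (auto simp: s_def M_def le_max_iff_disj)
    show "0 \<le> M" "M \<le> 1" using pq by (auto simp: M_def)
    show "\<bar>s l - s t\<bar> + \<bar>s l + s m\<bar> + \<bar>s m - s t\<bar> \<le> 2"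
      if "l \<in> letters A B" "m \<in> letters A B" "isl l = isl m" "push A B l [m] = [t]" for l m t
      using that
      by (cases l; cases m)
        (auto simp: letters_def s_def intro!: s1(4) s2(4) split: if_splits)
  qed
  define g where "g = commutator (free_product A B) (fp_inl A a) (fp_inr B b)"
  define c where "c = real (commutator_length (free_product A B) (g [^]\<^bsub>free_product A B\<^esub> n))"
  have ab: "fp_inl A a \<in> carrier (free_product A B)" "fp_inr B b \<in> carrier (free_product A B)"
    using a b by (auto simp: fp_inl_def fp_inr_def free_product_def reduced_words_Cons letters_def)
  have "turning s (g [^]\<^bsub>free_product A B\<^esub> n) \<le> 4 * (2 * M) * c"
    unfolding c_def
  proof (rule FP.quasimorphism_le_commutator_length)
    show "g [^]\<^bsub>free_product A B\<^esub> n \<in> commutator_products (free_product A B) n"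
      unfolding g_def by (rule FP.commutator_pow_in_products[OF ab])
  next
    fix x y assume "x \<in> carrier (free_product A B)" "y \<in> carrier (free_product A B)"
    then show "\<bar>turning s (x \<otimes>\<^bsub>free_product A B\<^esub> y) - turning s x - turning s y\<bar> \<le> 2 * M"
      using turning_defect by (simp add: free_product_def)
  next
    fix x assume "x \<in> carrier (free_product A B)"
    then have "x \<in> reduced_words A B" by (simp add: free_product_def)
    then show "turning s (inv\<^bsub>free_product A B\<^esub> x) = - turning s x"
      by (simp add: inv_word_is_inv turning_inv_word)
  qed
  then have "(4 * real n - 1) * (p * q) \<le> 8 * M * c"
    using turning_commutator_pow[OF a b, of m] s1(1) s2(1) by (simp add: n g_def s_def add.commute)
  moreover have "p * q = M * (2 * L)" by (auto simp: M_def L max_def min_def)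
  ultimately have "M * ((4 * real n - 1) * (2 * L)) \<le> M * (8 * c)" by (simp add: algebra_simps)
  moreover have "0 < M" using pq by (simp add: M_def less_max_iff_disj)
  ultimately have "(4 * real n - 1) * (2 * L) \<le> 8 * c" by (simp only: mult_le_cancel_left_pos)
  \<comment> \<open>The off-by-one in \<open>4 * n - 1\<close> costs \<open>L / 4\<close>, which the
    constant 1 absorbs.\<close>
  moreover have "L \<le> 1 / 2" using pq by (auto simp: L)
  ultimately show ?thesis by (simp add: algebra_simps c_def g_def)
qed

section \<open>Orders in the free product and the value of scl\<close>

lemma (in free_product_groups) ord_fp_inl:
  assumes "a \<in> carrier A"
  shows "FP.ord (fp_inl A a) = A.ord a"
proof -
  have cl: "fp_inl A a \<in> carrier (free_product A B)"
    using fp_inl_hom[OF A B] assms by (auto simp: hom_def)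
  have "fp_inl A a [^]\<^bsub>free_product A B\<^esub> n = fp_inl A (a [^]\<^bsub>A\<^esub> n)" for n :: nat
    using hom_nat_pow[OF fp_inl_hom[OF A B] assms A FP.is_group] by simp
  then have "(fp_inl A a :: ('a + 'b) list) [^]\<^bsub>free_product A B\<^esub> n = \<one>\<^bsub>free_product A B\<^esub>
      \<longleftrightarrow> a [^]\<^bsub>A\<^esub> n = \<one>\<^bsub>A\<^esub>" for n :: nat
    by (simp add: fp_inl_def free_product_def)
  \<comment> \<open>Both orders divide exactly the same exponents, which determines them even when
    they are 0.\<close>
  then show ?thesis
    using FP.pow_eq_id[OF cl] A.pow_eq_id[OF assms] by (metis dvd_antisym dvd_refl)
qed

lemma (in free_product_groups) ord_fp_inr:
  assumes "b \<in> carrier B"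
  shows "FP.ord (fp_inr B b) = B.ord b"
proof -
  have cl: "fp_inr B b \<in> carrier (free_product A B)"
    using fp_inr_hom[OF A B] assms by (auto simp: hom_def)
  have "fp_inr B b [^]\<^bsub>free_product A B\<^esub> n = fp_inr B (b [^]\<^bsub>B\<^esub> n)" for n :: nat
    using hom_nat_pow[OF fp_inr_hom[OF A B] assms B FP.is_group] by simp
  then have "(fp_inr B b :: ('a + 'b) list) [^]\<^bsub>free_product A B\<^esub> n = \<one>\<^bsub>free_product A B\<^esub>
      \<longleftrightarrow> b [^]\<^bsub>B\<^esub> n = \<one>\<^bsub>B\<^esub>" for n :: nat
    by (simp add: fp_inr_def free_product_def)
  then show ?thesis
    using FP.pow_eq_id[OF cl] B.pow_eq_id[OF assms] by (metis dvd_antisym dvd_refl)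
qed

text \<open>The upper bound holds for each order separately, hence for the minimum, which is the
  slope of the lower bound.\<close>

lemma (in free_product_groups) scl_commutator:
  assumes a: "a \<in> carrier A - {\<one>\<^bsub>A\<^esub>}" and b: "b \<in> carrier B - {\<one>\<^bsub>B\<^esub>}"
  shows "scl (free_product A B) (commutator (free_product A B) (fp_inl A a) (fp_inr B b)) =
    min (1 / 2 - 1 / real (A.ord a)) (1 / 2 - 1 / real (B.ord b))"
proof -
  define a' b' where "a' = (fp_inl A a :: ('a + 'b) list)" and "b' = (fp_inr B b :: ('a + 'b) list)"
  have ab: "a' \<in> carrier (free_product A B)" "b' \<in> carrier (free_product A B)"
    "a' \<noteq> \<one>\<^bsub>free_product A B\<^esub>" "b' \<noteq> \<one>\<^bsub>free_product A B\<^esub>"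
    using a b
    by (auto simp: a'_def b'_def fp_inl_def fp_inr_def free_product_def reduced_words_Cons letters_def)
  have ord: "FP.ord a' = A.ord a" "FP.ord b' = B.ord b"
    using a b by (simp_all add: a'_def b'_def ord_fp_inl ord_fp_inr)
  obtain C where "real (commutator_length (free_product A B)
        (commutator (free_product A B) a' b' [^]\<^bsub>free_product A B\<^esub> n))
      \<le> min (1 / 2 - 1 / real (A.ord a)) (1 / 2 - 1 / real (B.ord b)) * real n + C" for n
    using FP.commutator_length_commutator_pow_le[OF ab(1,3,2)]
      FP.commutator_length_commutator_pow_le'[OF ab(1,2,4)]
    unfolding ord by (metis min_def)
  then show ?thesis
    using commutator_length_commutator_pow_ge[OF a b]
    unfolding a'_def b'_def by (intro scl_eqI) blast+
qed

lemma (in group) element_order_ge_2: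
  assumes "x \<in> carrier G" "x \<noteq> \<one>"
  shows "2 \<le> element_order G x"
proof -
  have "ord x \<noteq> 1" using assms ord_eq_1 by blast
  then show ?thesis by (auto simp: element_order_def)
qed

theorem proposition5p6:
  fixes A :: "('a, 'm) monoid_scheme" and B :: "('b, 'n) monoid_scheme"
    and a :: 'a and b :: 'b and k :: enat
  assumes "group A" and "group B"
    and "a \<in> carrier A - {\<one>\<^bsub>A\<^esub>}" and "b \<in> carrier B - {\<one>\<^bsub>B\<^esub>}"
    and "k = min (element_order A a) (element_order B b)"
  shows "2 \<le> k \<and>
    ereal (scl (free_product A B) (commutator (free_product A B) (fp_inl A a) (fp_inr B b)))
      = 1 / 2 - 1 / ereal_of_enat k"
proof -
  interpret free_product_groups A B using assms(1,2) by (rule free_product_groups.intro)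
  have "2 \<le> k"
    using A.element_order_ge_2[of a] B.element_order_ge_2[of b] assms by simp
  \<comment> \<open>For infinite order both sides are 1/2: \<open>1 / \<infinity> = 0\<close> in
    \<open>ereal\<close> on the left, \<open>1 / real 0 = 0\<close> on the right.\<close>
  have half: "1 / 2 - 1 / ereal_of_enat (element_order G x) = ereal (1 / 2 - 1 / real (group.ord G x))"
    for G :: "('c, 'd) monoid_scheme" and x
    by (auto simp: element_order_def ereal_of_enat_def one_ereal_def numeral_eq_ereal)
  have le: "1 / 2 - 1 / real (group.ord G x) \<le> 1 / 2 - 1 / real (group.ord H y)"
    if "element_order G x \<le> element_order H y"
    for G :: "('c, 'd) monoid_scheme" and x and H :: "('e, 'f) monoid_scheme" and y
    using that by (auto simp: element_order_def field_simps split: if_splits)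
  have "ereal (min (1 / 2 - 1 / real (A.ord a)) (1 / 2 - 1 / real (B.ord b))) = 1 / 2 - 1 / ereal_of_enat k"
  proof (cases "element_order A a \<le> element_order B b")
    case True
    then show ?thesis using le[OF True] half[of A a] assms(5) by (simp add: min_def)
  next
    case False
    then have "element_order B b \<le> element_order A a" by simp
    from le[OF this] show ?thesis using half[of B b] assms(5) False by (simp add: min_def)
  qed
  then show ?thesis using \<open>2 \<le> k\<close> scl_commutator[OF assms(3,4)] by simp
qed

end
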